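(* Let $f$ be a quadratic unit as in the context. Then \[ j^{\rm qt}(f)=\{\,j(\mathfrak a_i): i=0,\dots,d-1\,\},\] where $\mathfrak a_i=(f,fT,\dots,fT^i)\subset A_{\infty_1}$.
   Context: Let $q$ be a prime power, $k=\mathbb F_q(T)$, $A=\mathbb F_q[T]$, $k_\infty=\mathbb F_q((1/T))$ with $|x|=q^{\deg_T x}$; $\|x\|$ is the distance from $x\in k_\infty$ to $A$. For $f\in k_\infty$ and $\varepsilon>0$ let $\Lambda_\varepsilon(f)=\{\lambda\in A:\|\lambda f\|<\varepsilon\}$, and $\zeta_{f,\varepsilon}(m)=\sum_{\lambda\in\Lambda_\varepsilon(f)\setminus\{0\},\ \lambda\text{ monic}}\lambda^{-m}$. Put $J_\varepsilon(f)=\frac{T^{q^2}-T}{(T^q-T)^{q+1}}\cdot\frac{\zeta_{f,\varepsilon}(q^2-1)}{\zeta_{f,\varepsilon}(q-1)^{q+1}}$ and $j_\varepsilon(f)=\big(\frac1{T^q-T}-J_\varepsilon(f)\big)^{-1}$. The quantum modular invariant $j^{\rm qt}(f)\subset k_\infty\cup\{\infty\}$ is the set of limits of convergent sequences $j_{\varepsilon_i}(f)$ with $\varepsilon_i\to0$. Now let $f\in k_\infty\setminus k$ be a quadratic unit: a root of $X^2-aX-b$ with $a\in A$ monic, $d:=\deg_T a\ge1$, $b\in\mathbb F_q^*$, with $|f|=q^d$. Let $K=k(f)\subset k_\infty$, $\infty_1$ the place of $K$ induced by this embedding, $A_{\infty_1}$ the ring of elements of $K$ regular away from $\infty_1$;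 one has $A_{\infty_1}=\mathbb F_q[f,fT,\dots,fT^{d-1}]$. An element of $A_{\infty_1}$ is monic if it can be written $c_0+c_1(T)f+\dots+c_k(T)f^k$ with $c_0\in\mathbb F_q$, $c_i\in A$ of degree $\le d-1$ for $i\ge1$, and $c_k$ monic (for $k=0$ this means the element is $1$). For a nonzero ideal $\mathfrak a\subset A_{\infty_1}$ let $\zeta^{\mathfrak a}(n(q-1))=\sum_{0\ne x\in\mathfrak a\text{ monic}}x^{n(1-q)}$, $J(\mathfrak a)=\frac{T^{q^2}-T}{(T^q-T)^{q+1}}\cdot\frac{\zeta^{\mathfrak a}(q^2-1)}{\zeta^{\mathfrak a}(q-1)^{q+1}}$ and $j(\mathfrak a)=\big(\frac1{T^q-T}-J(\mathfrak a)\big)^{-1}$. *)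

theory Defs
  imports "HOL-Analysis.Analysis" "HOL-Computational_Algebra.Computational_Algebra"
begin

text \<open>Conventions. The base field F_q is a finite field type 'a, q = CARD('a).
 k_infinity = F_q((1/T)) is modelled as the type 'a fls of formal Laurent series in
 X = 1/T (finitely many negative powers of X), so T = fls_X_inv.
 The library metric on 'a fls induces the same topology as the absolute value
 |x| = q^(deg_T x) = q^(- subdegree x).\<close>

abbreviation qcard :: "'a::{field,finite} itself \<Rightarrow> nat" where
  "qcard _ \<equiv> CARD('a)"

definition TT :: "'a::field fls" where
  "TT = fls_X_inv"

definition polyT :: "'a::field poly \<Rightarrow> 'a fls" where
  "polyT p = poly (map_poly fls_const p) TT"

definition absv :: "'a::{field,finite} fls \<Rightarrow> real" where
  "absv x = (if x = 0 then 0 else real CARD('a) powr (of_int (- fls_subdegree x)))"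

definition distA :: "'a::{field,finite} fls \<Rightarrow> real" where
  "distA x = Inf ((\<lambda>p. absv (x - polyT p)) ` UNIV)"

definition Lambda_eps :: "'a::{field,finite} fls \<Rightarrow> real \<Rightarrow> 'a poly set" where
  "Lambda_eps f \<epsilon> = {lam. distA (polyT lam * f) < \<epsilon>}"

definition zeta_eps :: "'a::{field,finite} fls \<Rightarrow> real \<Rightarrow> nat \<Rightarrow> 'a fls" where
  "zeta_eps f \<epsilon> m =
     infsum (\<lambda>lam. inverse (polyT lam) ^ m) {lam \<in> Lambda_eps f \<epsilon>. lam \<noteq> 0 \<and> lead_coeff lam = 1}"

definition Jfac :: "'a::{field,finite} itself \<Rightarrow> 'a fls" where
  "Jfac _ = (TT ^ (CARD('a)^2) - TT) / (TT ^ CARD('a) - TT) ^ (CARD('a) + 1)"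

text \<open>j from the two zeta values; k_infinity \<union> {\<infinity>} is 'a fls option with None = \<infinity>.\<close>
definition j_of :: "'a::{field,finite} fls \<Rightarrow> 'a fls \<Rightarrow> 'a fls option" where
  "j_of z1 z2 =
    (let q = CARD('a);
         J = Jfac TYPE('a) * (z2 / z1 ^ (q + 1));
         D = 1 / (TT ^ q - TT) - J
     in if D = 0 then None else Some (inverse D))"

definition j_eps :: "'a::{field,finite} fls \<Rightarrow> real \<Rightarrow> 'a fls option" where
  "j_eps f \<epsilon> = j_of (zeta_eps f \<epsilon> (CARD('a) - 1)) (zeta_eps f \<epsilon> (CARD('a)^2 - 1))"

definition conv_P1 :: "(nat \<Rightarrow> 'a::{field,finite} fls option) \<Rightarrow> 'a fls option \<Rightarrow> bool" where
  "conv_P1 x l =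
    (case l of
       None \<Rightarrow> (\<forall>M::real. eventually (\<lambda>n. x n = None \<or> absv (the (x n)) > M) sequentially)
     | Some L \<Rightarrow> eventually (\<lambda>n. x n \<noteq> None) sequentially \<and> (\<lambda>n. the (x n)) \<longlonglongrightarrow> L)"

definition jqt :: "'a::{field,finite} fls \<Rightarrow> 'a fls option set" where
  "jqt f = {l. \<exists>\<epsilon>::nat \<Rightarrow> real. (\<forall>i. \<epsilon> i > 0) \<and> \<epsilon> \<longlonglongrightarrow> 0 \<and> conv_P1 (\<lambda>i. j_eps f (\<epsilon> i)) l}"

definition kfield :: "'a::field fls set" where
  "kfield = {polyT p / polyT r | p r. r \<noteq> 0}"

inductive_set Ainf1 :: "'a::field fls \<Rightarrow> nat \<Rightarrow> 'a fls set" for f d where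
  const: "fls_const c \<in> Ainf1 f d"
| gen: "i < d \<Longrightarrow> f * TT ^ i \<in> Ainf1 f d"
| add: "x \<in> Ainf1 f d \<Longrightarrow> y \<in> Ainf1 f d \<Longrightarrow> x + y \<in> Ainf1 f d"
| neg: "x \<in> Ainf1 f d \<Longrightarrow> - x \<in> Ainf1 f d"
| mult: "x \<in> Ainf1 f d \<Longrightarrow> y \<in> Ainf1 f d \<Longrightarrow> x * y \<in> Ainf1 f d"

definition monicA :: "'a::field fls \<Rightarrow> nat \<Rightarrow> 'a fls \<Rightarrow> bool" where
  "monicA f d x \<longleftrightarrow> x = 1 \<or>
     (\<exists>c0 (c::nat \<Rightarrow> 'a poly) k. k \<ge> 1 \<and> (\<forall>i\<in>{1..k}. degree (c i) \<le> d - 1) \<and>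
        lead_coeff (c k) = 1 \<and>
        x = fls_const c0 + (\<Sum>i=1..k. polyT (c i) * f ^ i))"

definition ideal_a :: "'a::field fls \<Rightarrow> nat \<Rightarrow> nat \<Rightarrow> 'a fls set" where
  "ideal_a f d i = {x. \<exists>r. (\<forall>j\<le>i. r j \<in> Ainf1 f d) \<and> x = (\<Sum>j\<le>i. r j * (f * TT ^ j))}"

definition zeta_ideal :: "'a::{field,finite} fls \<Rightarrow> nat \<Rightarrow> 'a fls set \<Rightarrow> nat \<Rightarrow> 'a fls" where
  "zeta_ideal f d I n =
     infsum (\<lambda>x. inverse x ^ (n * (CARD('a) - 1))) {x \<in> I. x \<noteq> 0 \<and> monicA f d x}"

definition j_ideal :: "'a::{field,finite} fls \<Rightarrow> nat \<Rightarrow> 'a fls set \<Rightarrow> 'a fls option" where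
  "j_ideal f d I = j_of (zeta_ideal f d I 1) (zeta_ideal f d I (CARD('a) + 1))"

end

theory Submission
  imports Defs
begin

text \<open>
  Let \<open>g = a - f\<close> be the conjugate of \<open>f\<close>, so \<open>f g = - b\<close> and \<open>|g| = q\<^bsup>-d\<^esup>\<close>, and consider the
  conjugate pairs \<open>(x, y) = (u + v f, u + v g)\<close> with \<open>u, v \<in> A\<close>. Since \<open>v g\<close> and \<open>- v f\<close> differ by
  the polynomial \<open>v a\<close>, a polynomial \<open>\<lambda>\<close> lies in \<open>\<Lambda>\<^sub>\<epsilon>(f)\<close> iff \<open>\<lambda> = v\<close> for such a pair with \<open>|y| < \<epsilon>\<close>,
  while \<open>\<aa>\<^sub>i\<close> is the set of all \<open>x\<close> belonging to a pair with \<open>|y| \<le> q\<^bsup>i-d\<^esup>\<close>. Multiplication of pairs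
  by \<open>(f, g)\<^sup>N\<close> therefore identifies \<open>\<aa>\<^sub>i\<close> with \<open>\<Lambda>\<^sub>\<epsilon>(f)\<close> when \<open>q\<^bsup>-M\<^esup> < \<epsilon> \<le> q\<^bsup>1-M\<^esup>\<close> with
  \<open>M = (N + 1) d - i\<close>. Under this identification \<open>\<lambda> (f - g) / f\<^sup>N = x - y (g / f)\<^sup>N\<close>, so after
  rescaling, which does not affect \<open>J\<close>, the zeta values of \<open>\<Lambda>\<^sub>\<epsilon>(f)\<close> converge to those of \<open>\<aa>\<^sub>i\<close> as
  \<open>N\<close> grows. Along any sequence \<open>\<epsilon>\<^sub>k \<rightarrow> 0\<close> some index \<open>i\<close> occurs infinitely often, which leaves no
  other limits.
\<close>

unbundle fps_syntax

section \<open>Formal Laurent series as a valued field\<close>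

text \<open>The coefficientwise form covers x = 0 for every n, which \<open>fls_subdegree\<close> (0
  at the zero series) would not, and makes the ultrametric inequality immediate.\<close>

definition val_ge :: "'a::zero fls \<Rightarrow> int \<Rightarrow> bool" where
  "val_ge x n \<longleftrightarrow> (\<forall>k<n. x $$ k = 0)"

lemma val_ge_iff: "val_ge x n \<longleftrightarrow> x = 0 \<or> n \<le> fls_subdegree x"
  unfolding val_ge_def
  by (metis fls_eq0_below_subdegree fls_subdegree_geI fls_zero_nth less_le_trans)

lemma val_ge_0 [simp]: "val_ge 0 n"
  by (simp add: val_ge_def)

lemma val_ge_mono: "val_ge x n \<Longrightarrow> m \<le> n \<Longrightarrow> val_ge x m"
  by (auto simp: val_ge_def)

lemma val_ge_add: "val_ge x n \<Longrightarrow> val_ge y n \<Longrightarrow> val_ge (x + y) n"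
  for x :: "'a::monoid_add fls"
  by (simp add: val_ge_def)

lemma val_ge_uminus [simp]: "val_ge (- x) n \<longleftrightarrow> val_ge x n"
  for x :: "'a::group_add fls"
  by (simp add: val_ge_def)

lemma val_ge_diff: "val_ge x n \<Longrightarrow> val_ge y n \<Longrightarrow> val_ge (x - y) n"
  for x :: "'a::group_add fls"
  by (simp add: val_ge_def)

lemma val_ge_minus_commute: "val_ge (x - y) n \<longleftrightarrow> val_ge (y - x) n"
  for x :: "'a::ab_group_add fls"
  using val_ge_uminus[of "x - y" n] by simp

lemma val_ge_sum: "(\<And>i. i \<in> A \<Longrightarrow> val_ge (h i) n) \<Longrightarrow> val_ge (sum h A) n"
  for h :: "'i \<Rightarrow> 'a::comm_monoid_add fls"
  by (induction A rule: infinite_finite_induct) (auto intro: val_ge_add)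

lemma val_ge_mult: "val_ge x n \<Longrightarrow> val_ge y m \<Longrightarrow> val_ge (x * y) (n + m)"
  for x :: "'a::idom fls"
  by (cases "x = 0 \<or> y = 0") (auto simp: val_ge_iff)

lemma val_ge_power: "val_ge x n \<Longrightarrow> val_ge (x ^ k) (int k * n)"
  for x :: "'a::idom fls"
proof (induction k)
  case 0
  show ?case by (simp add: val_ge_iff)
next
  case (Suc k)
  then show ?case using val_ge_mult[of x n "x ^ k" "int k * n"]
    by (simp add: algebra_simps)
qed

text \<open>A perturbation of strictly larger valuation does not touch the leading term. Every later
  comparison of leading coefficients rests on this.\<close>

lemma subdegree_add_val_ge:
  fixes x e :: "'a::ab_group_add fls"
  assumes "x \<noteq> 0" "val_ge e n" "fls_subdegree x < n"
  shows "x + e \<noteq> 0" "fls_subdegree (x + e) = fls_subdegree x"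
    "(x + e) $$ fls_subdegree (x + e) = x $$ fls_subdegree x"
proof -
  have e0: "e $$ k = 0" if "k \<le> fls_subdegree x" for k
    using assms that by (simp add: val_ge_def)
  show eq: "fls_subdegree (x + e) = fls_subdegree x"
    using assms(1) by (intro fls_subdegree_eqI) (auto simp: e0)
  show lead: "(x + e) $$ fls_subdegree (x + e) = x $$ fls_subdegree x"
    by (simp add: eq e0)
  have "(x + e) $$ fls_subdegree (x + e) \<noteq> 0"
    using assms(1) unfolding lead by simp
  then show "x + e \<noteq> 0" by (metis nth_fls_subdegree_zero_iff)
qed

lemma lead_mult:
  fixes x y :: "'a::idom fls"
  assumes "x \<noteq> 0" "y \<noteq> 0"
  shows "(x * y) $$ fls_subdegree (x * y) = x $$ fls_subdegree x * y $$ fls_subdegree y"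
  using assms by (simp add: fls_times_base)

lemma lead_power:
  fixes x :: "'a::idom fls"
  assumes "x \<noteq> 0"
  shows "(x ^ n) $$ fls_subdegree (x ^ n) = (x $$ fls_subdegree x) ^ n"
proof (induction n)
  case (Suc n)
  then show ?case using lead_mult[of x "x ^ n"] assms by (simp del: fls_subdegree_mult)
qed simp

section \<open>Convergence of Laurent series expressed by valuations\<close>

lemma dist_fls_less_iff: "dist x y < inverse (2 ^ n) \<longleftrightarrow> val_ge (x - y) (int n + 1)"
  for x y :: "'a::group_add fls"
proof (cases "x = y")
  case False
  then have ne: "x - y \<noteq> 0" by simp
  let ?s = "fls_subdegree (x - y)"
  show ?thesis
  proof (cases "?s \<ge> 0")
    case True
    have "inverse ((2::real) ^ nat ?s) < inverse (2 ^ n) \<longleftrightarrow> (2::real) ^ n < 2 ^ nat ?s"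
      by (simp add: inverse_less_iff_less)
    also have "\<dots> \<longleftrightarrow> n < nat ?s" by simp
    finally show ?thesis using True False ne by (auto simp: dist_fls_def val_ge_iff)
  next
    case False
    have "inverse ((2::real) ^ n) \<le> 1" by (simp add: inverse_le_1_iff)
    moreover have "(1::real) \<le> 2 ^ nat (- ?s)" by simp
    ultimately have "\<not> (2::real) ^ nat (- ?s) < inverse (2 ^ n)" by linarith
    then show ?thesis using False \<open>x \<noteq> y\<close> ne by (auto simp: dist_fls_def val_ge_iff)
  qed
qed simp

text \<open>The library metric has base 2 while \<open>absv\<close> has base q. Stating convergence
  through valuations makes the base irrelevant.\<close>

lemma tendsto_fls_iff:
  fixes h :: "'i \<Rightarrow> 'a::ab_group_add fls"
  shows "(h \<longlongrightarrow> L) F \<longleftrightarrow> (\<forall>n. eventually (\<lambda>i. val_ge (h i - L) n) F)"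
proof
  assume L: "(h \<longlongrightarrow> L) F"
  show "\<forall>n. eventually (\<lambda>i. val_ge (h i - L) n) F"
  proof
    fix n
    have "eventually (\<lambda>i. dist (h i) L < inverse (2 ^ nat n)) F"
      using L by (intro tendstoD) auto
    then show "eventually (\<lambda>i. val_ge (h i - L) n) F"
      unfolding dist_fls_less_iff by eventually_elim (erule val_ge_mono, simp)
  qed
next
  assume *: "\<forall>n. eventually (\<lambda>i. val_ge (h i - L) n) F"
  show "(h \<longlongrightarrow> L) F"
  proof (rule tendstoI)
    fix e :: real assume "e > 0"
    then obtain n where n: "inverse (2 ^ n) < e"
      using real_arch_pow_inv[of e "1/2"] by (auto simp: power_one_over inverse_eq_divide)
    have "eventually (\<lambda>i. val_ge (h i - L) (int n + 1)) F" using * by blast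
    then show "eventually (\<lambda>i. dist (h i) L < e) F"
      unfolding dist_fls_less_iff[symmetric] by eventually_elim (use n in linarith)
  qed
qed

lemma tendsto_fls_diff:
  fixes h k :: "'i \<Rightarrow> 'a::ab_group_add fls"
  assumes "(h \<longlongrightarrow> L) F" "(k \<longlongrightarrow> M) F"
  shows "((\<lambda>i. h i - k i) \<longlongrightarrow> L - M) F"
  unfolding tendsto_fls_iff
proof
  fix n
  have "eventually (\<lambda>i. val_ge (h i - L) n) F" "eventually (\<lambda>i. val_ge (k i - M) n) F"
    using assms by (auto simp: tendsto_fls_iff)
  then show "eventually (\<lambda>i. val_ge (h i - k i - (L - M)) n) F"
  proof eventually_elim
    case (elim i)
    then show ?case using val_ge_diff[OF elim] by (simp add: algebra_simps)
  qed
qed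

lemma tendsto_fls_mult:
  fixes h k :: "'i \<Rightarrow> 'a::idom fls"
  assumes "(h \<longlongrightarrow> L) F" "(k \<longlongrightarrow> M) F"
  shows "((\<lambda>i. h i * k i) \<longlongrightarrow> L * M) F"
  unfolding tendsto_fls_iff
proof
  fix n
  define c where "c = min 0 (min (fls_subdegree L) (fls_subdegree M))"
  have c: "val_ge L c" "val_ge M c" "c \<le> 0" by (auto simp: val_ge_iff c_def)
  \<comment> \<open>The mixed error terms need m + c \<ge> n. The product of both errors needs 2 m
    \<ge> n, which follows since c \<le> 0 gives m \<ge> 0 and m \<ge> n.\<close>
  define m where "m = max 0 n - c"
  have "eventually (\<lambda>i. val_ge (h i - L) m) F" "eventually (\<lambda>i. val_ge (k i - M) m) F"
    using assms by (auto simp: tendsto_fls_iff)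
  then show "eventually (\<lambda>i. val_ge (h i * k i - L * M) n) F"
  proof eventually_elim
    case (elim i)
    have "h i * k i - L * M = (h i - L) * (k i - M) + L * (k i - M) + (h i - L) * M"
      by (simp add: algebra_simps)
    moreover have "val_ge ((h i - L) * (k i - M)) n"
      using val_ge_mult[OF elim] c by (elim val_ge_mono) (auto simp: m_def)
    moreover have "val_ge (L * (k i - M)) n"
      using val_ge_mult[OF c(1) elim(2)] by (elim val_ge_mono) (auto simp: m_def)
    moreover have "val_ge ((h i - L) * M) n"
      using val_ge_mult[OF elim(1) c(2)] by (elim val_ge_mono) (auto simp: m_def)
    ultimately show ?case by (auto intro: val_ge_add)
  qed
qed

lemma tendsto_fls_power:
  fixes h :: "'i \<Rightarrow> 'a::idom fls"
  assumes "(h \<longlongrightarrow> L) F"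
  shows "((\<lambda>i. h i ^ n) \<longlongrightarrow> L ^ n) F"
  using assms by (induction n) (auto intro: tendsto_fls_mult)

lemma eventually_fls_subdegree_eq:
  fixes h :: "'i \<Rightarrow> 'a::ab_group_add fls"
  assumes "(h \<longlongrightarrow> L) F" "L \<noteq> 0"
  shows "eventually (\<lambda>i. h i \<noteq> 0 \<and> fls_subdegree (h i) = fls_subdegree L) F"
proof -
  have "eventually (\<lambda>i. val_ge (h i - L) (fls_subdegree L + 1)) F"
    using assms by (auto simp: tendsto_fls_iff)
  then show ?thesis
  proof eventually_elim
    case (elim i)
    show ?case using subdegree_add_val_ge[OF assms(2) elim] by simp
  qed
qed

lemma tendsto_fls_inverse:
  fixes h :: "'i \<Rightarrow> 'a::field fls"
  assumes "(h \<longlongrightarrow> L) F" "L \<noteq> 0"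
  shows "((\<lambda>i. inverse (h i)) \<longlongrightarrow> inverse L) F"
  unfolding tendsto_fls_iff
proof
  fix n
  let ?s = "fls_subdegree L"
  \<comment> \<open>Once h i has the valuation of L, the product of the two inverses has valuation
    -2 times that of L; the extra precision compensates for this factor.\<close>
  have "eventually (\<lambda>i. val_ge (h i - L) (n + 2 * ?s)) F"
    using assms by (auto simp: tendsto_fls_iff)
  with eventually_fls_subdegree_eq[OF assms]
  show "eventually (\<lambda>i. val_ge (inverse (h i) - inverse L) n) F"
  proof eventually_elim
    case (elim i)
    have "inverse (h i) - inverse L = (L - h i) * (inverse (h i) * inverse L)"
      using elim assms(2) by (simp add: field_simps)
    moreover have "val_ge (inverse (h i) * inverse L) (- 2 * ?s)"
      using elim assms(2) by (simp add: val_ge_iff)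
    moreover have "val_ge (L - h i) (n + 2 * ?s)"
      using elim val_ge_minus_commute by blast
    ultimately show ?case using val_ge_mult by fastforce
  qed
qed

lemma one_less_CARD_field: "1 < CARD('a::{field,finite})"
proof -
  have "card {0, 1::'a} \<le> CARD('a)" by (intro card_mono) auto
  then show ?thesis by simp
qed

lemma absv_gt_iff_not_val_ge:
  fixes x :: "'a::{field,finite} fls"
  shows "real CARD('a) powr real_of_int m < absv x \<longleftrightarrow> \<not> val_ge x (- m)"
proof -
  show ?thesis using one_less_CARD_field[where 'a='a] by (auto simp: absv_def val_ge_iff not_less)
qed

text \<open>The nonzero values of \<open>absv\<close> are integral powers of q, so all radii in one
  half-open interval between consecutive powers cut out the same ball.\<close>

lemma absv_less_iff:
  fixes x :: "'a::{field,finite} fls"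
  assumes "real CARD('a) powr - real_of_int M < \<epsilon>" "\<epsilon> \<le> real CARD('a) powr (1 - real_of_int M)"
  shows "absv x < \<epsilon> \<longleftrightarrow> val_ge x M"
proof -
  let ?q = "real CARD('a)"
  have q: "1 < ?q" using one_less_CARD_field[where 'a='a] by simp
  have "\<epsilon> > 0" using assms(1) powr_ge_zero[of ?q] by (meson le_less_trans)
  show ?thesis
  proof
    assume "absv x < \<epsilon>"
    show "val_ge x M"
    proof (rule ccontr)
      assume "\<not> val_ge x M"
      then have "x \<noteq> 0" "fls_subdegree x + 1 \<le> M" by (auto simp: val_ge_iff)
      then have "?q powr (1 - real_of_int M) \<le> absv x"
        using q by (simp add: absv_def)
      then show False using \<open>absv x < \<epsilon>\<close> assms(2) by linarith
    qed
  next
    assume "val_ge x M"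
    then have "absv x \<le> ?q powr - real_of_int M"
      using q by (auto simp: absv_def val_ge_iff)
    then show "absv x < \<epsilon>" using assms(1) by linarith
  qed
qed

section \<open>Unordered infinite sums of Laurent series\<close>

lemma has_sum_fls_iff:
  fixes h :: "'i \<Rightarrow> 'a::ab_group_add fls"
  shows "(h has_sum L) A \<longleftrightarrow>
    (\<forall>n. eventually (\<lambda>F. val_ge (sum h F - L) n) (finite_subsets_at_top A))"
  by (simp add: has_sum_def tendsto_fls_iff)

lemma has_sum_fls_cmult_right:
  fixes h :: "'i \<Rightarrow> 'a::idom fls"
  assumes "(h has_sum L) A"
  shows "((\<lambda>i. c * h i) has_sum (c * L)) A"
  using tendsto_fls_mult[OF tendsto_const, of "sum h" L _ c] assms
  by (simp add: has_sum_def sum_distrib_left)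

text \<open>By the ultrametric inequality a uniform termwise bound passes to infinite sums without
  loss.\<close>

lemma has_sum_fls_close:
  fixes h k :: "'i \<Rightarrow> 'a::ab_group_add fls"
  assumes "(h has_sum L) A" "(k has_sum M) A" "\<And>i. i \<in> A \<Longrightarrow> val_ge (h i - k i) n"
  shows "val_ge (L - M) n"
proof -
  have "eventually (\<lambda>F. val_ge (L - M) n) (finite_subsets_at_top A)"
    using assms(1,2)[unfolded has_sum_fls_iff, rule_format, of n]
      eventually_finite_subsets_at_top_weakI[of A "\<lambda>F. finite F \<and> F \<subseteq> A", simplified]
  proof eventually_elim
    case (elim F)
    have "val_ge (\<Sum>i\<in>F. h i - k i) n"
      using elim assms(3) by (intro val_ge_sum) auto
    note close = this[unfolded sum_subtractf]
    have "val_ge ((sum h F - sum k F) - (sum h F - L) + (sum k F - M)) n"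
      using val_ge_add[OF val_ge_diff[OF close elim(1)] elim(2)] .
    then show ?case by (simp add: algebra_simps)
  qed
  then show ?thesis by (simp add: eventually_const_iff)
qed

text \<open>Only finitely many terms contribute to any given coefficient, so the sum is built
  coefficient by coefficient. The set \<open>B (k + 1)\<close> contains every term with a nonzero
  coefficient at k.\<close>

lemma summable_on_fls:
  fixes h :: "'i \<Rightarrow> 'a::ab_group_add fls"
  assumes fin: "\<And>n. finite {i \<in> A. \<not> val_ge (h i) n}"
  shows "h summable_on A"
proof -
  define B where "B n = {i \<in> A. \<not> val_ge (h i) n}" for n
  have finB: "finite (B n)" for n using fin by (simp add: B_def)
  define s where "s k = (\<Sum>i\<in>B (k + 1). h i $$ k)" for k
  have sum_eq: "sum h F $$ k = s k" if "finite F" "B (k + 1) \<subseteq> F" "F \<subseteq> A" for F k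
  proof -
    have "sum h F $$ k = (\<Sum>i\<in>F. h i $$ k)" 
      using \<open>finite F\<close> by (induction F) auto
    also have "\<dots> = s k"
      unfolding s_def using that by (intro sum.mono_neutral_right) (auto simp: B_def val_ge_def)
    finally show ?thesis .
  qed
  have nthL: "Abs_fls s $$ k = s k" for k
  proof -
    \<comment> \<open>\<open>Abs_fls\<close> needs coefficients that vanish below some index. Terms
      outside \<open>B 0\<close> have no negative exponents, and the finite set \<open>B 0\<close>
      supplies the rest of the bound; the inserted 0 ensures m \<le> 0 and a nonempty set.\<close>
    define m where "m = Min (insert 0 ((\<lambda>i. fls_subdegree (h i)) ` B 0))"
    have "s j = 0" if "j < m" for j
    proof -
      have m: "m \<le> 0" "\<And>i. i \<in> B 0 \<Longrightarrow> m \<le> fls_subdegree (h i)"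
        using finB by (auto simp: m_def)
      have "h i $$ j = 0" if "i \<in> A" for i
      proof (cases "i \<in> B 0")
        case True then show ?thesis using m(2)[OF True] \<open>j < m\<close> by simp
      next
        case False
        then show ?thesis using that m(1) \<open>j < m\<close> by (auto simp: B_def val_ge_def)
      qed
      then show ?thesis unfolding s_def B_def by (intro sum.neutral) auto
    qed
    then show ?thesis by (intro nth_Abs_fls_lower_bound) auto
  qed
  have "(h has_sum Abs_fls s) A"
    unfolding has_sum_fls_iff
  proof
    fix n
    have mono: "B k \<subseteq> B n" if "k \<le> n" for k
      using that by (auto simp: B_def intro: val_ge_mono)
    show "eventually (\<lambda>F. val_ge (sum h F - Abs_fls s) n) (finite_subsets_at_top A)"
      unfolding eventually_finite_subsets_at_top
    proof (intro exI[of _ "B n"] conjI allI impI)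
      fix F assume F: "finite F \<and> B n \<subseteq> F \<and> F \<subseteq> A"
      show "val_ge (sum h F - Abs_fls s) n"
        unfolding val_ge_def
      proof (intro allI impI)
        fix k assume "k < n"
        then have "sum h F $$ k = s k" using F mono[of "k + 1"] by (intro sum_eq) auto
        then show "(sum h F - Abs_fls s) $$ k = 0" by (simp add: nthL)
      qed
    qed (use finB in \<open>auto simp: B_def\<close>)
  qed
  then show ?thesis by (auto simp: summable_on_def)
qed

lemma val_ge_power_diff:
  fixes x y :: "'a::idom fls"
  assumes "val_ge x 0" "val_ge y 0" "val_ge (x - y) n"
  shows "val_ge (x ^ m - y ^ m) n"
proof (induction m)
  case (Suc m)
  have "val_ge (x * (x ^ m - y ^ m)) (0 + n)" "val_ge ((x - y) * y ^ m) (n + 0)"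
    using val_ge_power[OF assms(2), of m] by (intro val_ge_mult assms Suc; simp)+
  then have "val_ge (x * (x ^ m - y ^ m) + (x - y) * y ^ m) n"
    by (intro val_ge_add) simp_all
  then show ?case by (simp add: algebra_simps)
qed simp

text \<open>Here |x| = |y| \<ge> 1, so both inverses lie in the valuation ring, and neither
  inversion nor taking powers loses precision.\<close>

lemma val_ge_inverse_power_diff:
  fixes x y :: "'a::field fls"
  assumes "x \<noteq> 0" "y \<noteq> 0" "fls_subdegree x \<le> 0" "fls_subdegree y = fls_subdegree x" "val_ge (x - y) n"
  shows "val_ge (inverse x ^ m - inverse y ^ m) n"
proof (rule val_ge_power_diff)
  show x0: "val_ge (inverse x) 0" and y0: "val_ge (inverse y) 0"
    using assms by (simp_all add: val_ge_iff)
  have "inverse x - inverse y = (y - x) * (inverse x * inverse y)"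
    using assms(1,2) by (simp add: field_simps)
  moreover have "val_ge (inverse x * inverse y) (0 + 0)"
    by (intro val_ge_mult x0 y0)
  moreover have "val_ge (y - x) n" using assms(5) val_ge_minus_commute by blast
  ultimately show "val_ge (inverse x - inverse y) n" using val_ge_mult by fastforce
qed

section \<open>Polynomials in \<open>T\<close>\<close>

lemma polyT_0 [simp]: "polyT 0 = 0"
  by (simp add: polyT_def)

lemma polyT_pCons: "polyT (pCons c p) = fls_const c + TT * polyT p"
  by (simp add: polyT_def map_poly_pCons)

lemma polyT_const [simp]: "polyT [:c:] = fls_const c"
  by (simp add: polyT_pCons)

lemma polyT_1 [simp]: "polyT 1 = 1"
  by (simp add: one_pCons polyT_pCons)

lemma polyT_add: "polyT (p + r) = polyT p + polyT r"
  by (induction p r rule: poly_induct2)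
    (simp_all add: polyT_pCons algebra_simps flip: fls_plus_const)

lemma polyT_uminus: "polyT (- p) = - polyT p"
  by (induction p) (simp_all add: polyT_pCons)

lemma polyT_diff: "polyT (p - r) = polyT p - polyT r"
  using polyT_add[of p "- r"] by (simp add: polyT_uminus)

lemma polyT_smult: "polyT (smult c p) = fls_const c * polyT p"
  by (induction p) (simp_all add: polyT_pCons algebra_simps flip: fls_const_mult_const)

lemma polyT_mult: "polyT (p * r) = polyT p * polyT r"
  by (induction p) (simp_all add: polyT_pCons polyT_add polyT_smult algebra_simps)

lemma polyT_eq_sum: "polyT p = (\<Sum>j\<le>degree p. fls_const (coeff p j) * TT ^ j)"
proof -
  have "degree (map_poly fls_const p) = degree p"
    by (cases "p = 0") (auto intro: map_poly_degree_eq)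
  then show ?thesis
    by (simp add: polyT_def poly_altdef coeff_map_poly)
qed

lemma polyT_nth: "polyT p $$ k = (if k \<le> 0 then coeff p (nat (- k)) else 0)"
proof (induction p arbitrary: k)
  case (pCons c p)
  have "(TT * polyT p) $$ k = polyT p $$ (k + 1)"
    by (simp add: TT_def fls_X_inv_times_conv_shift)
  moreover have "coeff (pCons c p) (nat (- k)) = coeff p (nat (- k - 1))" if "k < 0"
  proof -
    have "nat (- k) = Suc (nat (- k - 1))" using that by simp
    then show ?thesis by simp
  qed
  ultimately show ?case using pCons.IH by (auto simp: polyT_pCons)
qed simp

lemma polyT_nth_subdegree:
  assumes "p \<noteq> 0"
  shows "polyT p \<noteq> 0" "fls_subdegree (polyT p) = - int (degree p)"
    "polyT p $$ fls_subdegree (polyT p) = lead_coeff p"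
proof -
  have lc: "polyT p $$ (- int (degree p)) = lead_coeff p"
    by (simp add: polyT_nth)
  show sd: "fls_subdegree (polyT p) = - int (degree p)"
    using assms by (intro fls_subdegree_eqI) (auto simp: polyT_nth intro: coeff_eq_0)
  show "polyT p $$ fls_subdegree (polyT p) = lead_coeff p"
    by (simp only: sd lc)
  show "polyT p \<noteq> 0" using lc assms by auto
qed

lemma polyT_eq_0_iff [simp]: "polyT p = 0 \<longleftrightarrow> p = 0"
  using polyT_nth_subdegree(1) by auto

lemma val_ge_polyT_iff: "val_ge (polyT p) (- int n) \<longleftrightarrow> degree p \<le> n"
  by (cases "p = 0") (auto simp: val_ge_iff polyT_nth_subdegree)

lemma val_ge_polyT_pos_imp_0: "val_ge (polyT p) 1 \<Longrightarrow> p = 0"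
  using polyT_nth_subdegree[of p] by (force simp: val_ge_iff)

text \<open>As T is the inverse of the series variable, the coefficients at nonpositive exponents
  form a polynomial in T; what remains has absolute value below 1.\<close>

lemma polynomial_part:
  fixes x :: "'a::field fls"
  assumes "val_ge x (- int n)"
  obtains r where "degree r \<le> n" "val_ge (x - polyT r) 1"
proof
  define r where "r = (\<Sum>j\<le>n. monom (x $$ (- int j)) j)"
  have cr: "coeff r j = (if j \<le> n then x $$ (- int j) else 0)" for j
    by (simp add: r_def coeff_sum)
  show "degree r \<le> n" by (intro degree_le) (simp add: cr)
  show "val_ge (x - polyT r) 1"
    using assms by (auto simp: val_ge_def polyT_nth cr)
qed

lemma finite_degree_le: "finite {p :: 'a::{finite,zero} poly. degree p \<le> n}"
proof -
  let ?X = "{xs :: 'a list. set xs \<subseteq> UNIV \<and> length xs \<le> Suc n}"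
  have "p \<in> Poly ` ?X" if "degree p \<le> n" for p :: "'a poly"
  proof
    show "p = Poly (coeffs p)" by simp
    show "coeffs p \<in> ?X"
      using that by (cases "p = 0") (auto simp: length_coeffs_degree)
  qed
  then have "{p :: 'a poly. degree p \<le> n} \<subseteq> Poly ` ?X" by auto
  moreover have "finite ?X" by (rule finite_lists_length_le) simp
  ultimately show ?thesis by (rule finite_subset[OF _ finite_imageI])
qed

lemma distA_less_iff: "distA x < \<epsilon> \<longleftrightarrow> (\<exists>p. absv (x - polyT p) < \<epsilon>)"
proof -
  have "bdd_below (range (\<lambda>p. absv (x - polyT p)))"
    by (rule bdd_belowI2[of _ 0]) (simp add: absv_def)
  then show ?thesis unfolding distA_def by (subst cInf_less_iff) auto
qed

section \<open>Limits in the projective line\<close>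

text \<open>A sequence with a finite limit is eventually finite and bounded, so it cannot also tend
  to infinity. Two finite limits agree because the metric topology is Hausdorff.\<close>

lemma conv_P1_unique:
  assumes "conv_P1 x l" "conv_P1 x l'"
  shows "l = l'"
proof -
  have ne: "\<not> conv_P1 x None" if "conv_P1 x (Some L)" for L
  proof
    assume "conv_P1 x None"
    define s where "s = min 0 (fls_subdegree L)"
    have Ls: "val_ge L s" by (auto simp: val_ge_iff s_def)
    from that have "eventually (\<lambda>n. x n \<noteq> None) sequentially"
      and "eventually (\<lambda>n. val_ge (the (x n) - L) s) sequentially"
      by (auto simp: conv_P1_def tendsto_fls_iff)
    moreover from \<open>conv_P1 x None\<close> have
      "eventually (\<lambda>n. x n = None \<or> absv (the (x n)) > real CARD('a) powr real_of_int (- s)) sequentially"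
      by (auto simp: conv_P1_def)
    ultimately have "eventually (\<lambda>n::nat. False) sequentially"
    proof eventually_elim
      case (elim n)
      have "val_ge (the (x n)) s" using val_ge_add[OF elim(2) Ls] by simp
      then show ?case using elim absv_gt_iff_not_val_ge[of "- s" "the (x n)"] by simp
    qed
    then show False by simp
  qed
  show ?thesis
  proof (cases l; cases l')
    fix L L' assume l: "l = Some L" "l' = Some L'"
    then have "(\<lambda>n. the (x n)) \<longlonglongrightarrow> L" "(\<lambda>n. the (x n)) \<longlonglongrightarrow> L'"
      using assms by (simp_all add: conv_P1_def)
    then have "L = L'" by (rule LIMSEQ_unique)
    then show ?thesis by (simp add: l)
  qed (use assms ne in auto)
qed

lemma conv_P1_subseq:
  assumes "conv_P1 x l" "strict_mono r"
  shows "conv_P1 (x \<circ> r) l"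
proof -
  have r: "filterlim r sequentially sequentially"
    using assms(2) by (rule filterlim_subseq)
  show ?thesis
  proof (cases l)
    case None
    have "eventually (\<lambda>n. x (r n) = None \<or> absv (the (x (r n))) > M) sequentially" for M
    proof -
      have "eventually (\<lambda>n. x n = None \<or> absv (the (x n)) > M) sequentially"
        using assms(1) by (simp add: None conv_P1_def)
      then show ?thesis by (rule eventually_compose_filterlim[OF _ r])
    qed
    then show ?thesis by (simp add: None conv_P1_def)
  next
    case (Some L)
    have *: "eventually (\<lambda>n. x n \<noteq> None) sequentially" "(\<lambda>n. the (x n)) \<longlonglongrightarrow> L"
      using assms(1) by (simp_all add: Some conv_P1_def)
    show ?thesis
      using eventually_compose_filterlim[OF *(1) r] filterlim_compose[OF *(2) r]
      by (simp add: Some conv_P1_def)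
  qed
qed

text \<open>Inversion is continuous into the projective line even at 0, so the limiting denominator
  of j may vanish and j may tend to infinity.\<close>

lemma conv_P1_inverse:
  assumes "D \<longlonglongrightarrow> L"
  shows "conv_P1 (\<lambda>n. if D n = 0 then None else Some (inverse (D n)))
    (if L = 0 then None else Some (inverse L))"
proof (cases "L = 0")
  case True
  have "eventually (\<lambda>n. D n = 0 \<or> M < absv (inverse (D n))) sequentially" for M
  proof -
    let ?q = "real CARD('a)"
    have q: "1 < ?q" using one_less_CARD_field[where 'a='a] by simp
    obtain k :: nat where k: "M < ?q ^ k" using real_arch_pow[OF q] by blast
    have "eventually (\<lambda>n. val_ge (D n - 0) (int k)) sequentially"
      using assms True unfolding tendsto_fls_iff by blast
    then show ?thesis
    proof eventually_elim
      case (elim n)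
      show ?case
      proof (cases "D n = 0")
        case False
        then have "int k \<le> fls_subdegree (D n)" using elim by (simp add: val_ge_iff)
        then have "?q powr real k \<le> absv (inverse (D n))"
          using False q by (simp add: absv_def)
        then show ?thesis using k q by (simp add: powr_realpow)
      qed simp
    qed
  qed
  then have "eventually (\<lambda>n. (if D n = 0 then None else Some (inverse (D n))) = None \<or>
      M < absv (the (if D n = 0 then None else Some (inverse (D n))))) sequentially" for M
    by (rule eventually_mono) auto
  then show ?thesis using True by (simp add: conv_P1_def)
next
  case False
  have ev: "eventually (\<lambda>n. D n \<noteq> 0) sequentially"
    using eventually_fls_subdegree_eq[OF assms False] by eventually_elim simp
  have "(\<lambda>n. the (if D n = 0 then None else Some (inverse (D n)))) \<longlonglongrightarrow> inverse L"
    using tendsto_fls_inverse[OF assms False]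
    by (rule Lim_transform_eventually) (use ev in eventually_elim, simp)
  then show ?thesis using False ev by (auto simp: conv_P1_def elim: eventually_mono)
qed

lemma conv_P1_j_of:
  fixes z1 z2 :: "'a::{field,finite} fls"
  assumes "X \<longlonglongrightarrow> z1" "Y \<longlonglongrightarrow> z2" "z1 \<noteq> 0"
  shows "conv_P1 (\<lambda>n. j_of (X n) (Y n)) (j_of z1 z2)"
proof -
  let ?q = "CARD('a)"
  define D where "D x y = 1 / (TT ^ ?q - TT) - Jfac TYPE('a) * (y / x ^ (?q + 1))" for x y :: "'a fls"
  have "(\<lambda>n. D (X n) (Y n)) \<longlonglongrightarrow> D z1 z2"
    unfolding D_def divide_inverse[of _ "_ ^ (?q + 1)"]
    using assms by (intro tendsto_fls_diff tendsto_fls_mult tendsto_fls_inverse tendsto_fls_power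
      tendsto_const) auto
  moreover have "j_of x y = (if D x y = 0 then None else Some (inverse (D x y)))" for x y
    by (simp only: j_of_def D_def Let_def)
  ultimately show ?thesis by (simp only: conv_P1_inverse)
qed

text \<open>The exponents satisfy (q - 1)(q + 1) = q^2 - 1, so the quotient inside J is homogeneous
  of weight 0. This removes the factor \<open>scale N\<close>, which depends on N.\<close>

lemma j_of_rescale:
  fixes c z1 z2 :: "'a::{field,finite} fls"
  assumes "c \<noteq> 0"
  shows "j_of (c ^ (CARD('a) - 1) * z1) (c ^ (CARD('a)^2 - 1) * z2) = j_of z1 z2"
proof -
  have "(CARD('a) - 1) * (CARD('a) + 1) = CARD('a)^2 - 1"
    by (simp add: algebra_simps power2_eq_square)
  then have "(c ^ (CARD('a) - 1)) ^ (CARD('a) + 1) = c ^ (CARD('a)^2 - 1)"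
    by (metis power_mult)
  then have "(c ^ (CARD('a)^2 - 1) * z2) / (c ^ (CARD('a) - 1) * z1) ^ (CARD('a) + 1)
      = z2 / z1 ^ (CARD('a) + 1)"
    using assms by (simp only: power_mult_distrib) simp
  then show ?thesis unfolding j_of_def Let_def by (simp only:)
qed

section \<open>Quadratic units and conjugate pairs\<close>

locale quadratic_unit =
  fixes f :: "'a::{field,finite} fls" and a :: "'a poly" and b :: 'a
  assumes irrational: "f \<notin> kfield"
    and deg_pos: "degree a \<ge> 1"
    and monic: "lead_coeff a = 1"
    and b_nonzero: "b \<noteq> 0"
    and root: "f ^ 2 - polyT a * f - fls_const b = 0"
    and absv_f: "absv f = real CARD('a) ^ degree a"
begin

definition g :: "'a fls" where "g = polyT a - f"

abbreviation d :: nat where "d \<equiv> degree a"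

lemma f_nonzero [simp]: "f \<noteq> 0"
  using absv_f one_less_CARD_field[where 'a='a] by (auto simp: absv_def)

lemma subdegree_f [simp]: "fls_subdegree f = - int d"
proof -
  have q: "1 < real CARD('a)" using one_less_CARD_field[where 'a='a] by simp
  have "real CARD('a) powr real_of_int (- fls_subdegree f) = real CARD('a) powr real d"
    using absv_f q by (simp add: absv_def powr_realpow)
  then have "real_of_int (- fls_subdegree f) = real d"
    using q by (simp only: powr_inj)
  then show ?thesis by linarith
qed

lemma f_times_g: "f * g = - fls_const b"
  using root by (simp add: g_def algebra_simps power2_eq_square)

lemma g_nonzero [simp]: "g \<noteq> 0"
  using f_times_g b_nonzero by auto

lemma subdegree_g [simp]: "fls_subdegree g = int d"
proof -
  have "fls_subdegree (f * g) = 0" by (simp add: f_times_g)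
  then show ?thesis by simp
qed

lemma lead_f: "f $$ (- int d) = 1"
proof -
  have "f $$ (- int d) = (polyT a - g) $$ (- int d)" by (simp add: g_def)
  moreover have "g $$ (- int d) = 0" using deg_pos by simp
  ultimately show ?thesis using monic by (simp add: polyT_nth)
qed

lemma diff_f_g:
  shows "f - g \<noteq> 0" "fls_subdegree (f - g) = - int d" "(f - g) $$ (- int d) = 1"
  using subdegree_add_val_ge[of f "- g" 1] lead_f deg_pos by (simp_all add: val_ge_iff)

text \<open>Galois conjugation on A[f] is encoded as a relation: the coordinates u, v are shared by
  both components, and no conjugation map has to be shown well defined.\<close>

inductive conj_pair :: "'a fls \<Rightarrow> 'a fls \<Rightarrow> bool" where
  "conj_pair (polyT u + polyT v * f) (polyT u + polyT v * g)"

lemma conj_pair_polyT: "conj_pair (polyT p) (polyT p)"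
  using conj_pair.intros[of p 0] by simp

lemma conj_pair_f: "conj_pair f g"
  using conj_pair.intros[of 0 1] by simp

lemma conj_pair_add:
  assumes "conj_pair x y" "conj_pair x' y'"
  shows "conj_pair (x + x') (y + y')"
proof -
  from assms(1) obtain u v where 1: "x = polyT u + polyT v * f" "y = polyT u + polyT v * g"
    by cases auto
  from assms(2) obtain u' v' where 2: "x' = polyT u' + polyT v' * f" "y' = polyT u' + polyT v' * g"
    by cases auto
  show ?thesis using conj_pair.intros[of "u + u'" "v + v'"]
    by (simp add: 1 2 polyT_add algebra_simps)
qed

text \<open>Both f and g are roots of h^2 = a h + b, so one computation with a generic root h yields
  the same coordinates for both products.\<close>

lemma conj_pair_mult:
  assumes "conj_pair x y" "conj_pair x' y'"
  shows "conj_pair (x * x') (y * y')"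
proof -
  from assms(1) obtain u v where 1: "x = polyT u + polyT v * f" "y = polyT u + polyT v * g"
    by cases auto
  from assms(2) obtain u' v' where 2: "x' = polyT u' + polyT v' * f" "y' = polyT u' + polyT v' * g"
    by cases auto
  have ff: "f * f = polyT a * f + fls_const b"
    using root by (simp add: power2_eq_square algebra_simps)
  have gg: "g * g = polyT a * g + fls_const b"
    using f_times_g unfolding g_def by (simp add: algebra_simps)
  have *: "(polyT u + polyT v * h) * (polyT u' + polyT v' * h)
      = polyT (u * u' + smult b (v * v')) + polyT (u * v' + v * u' + v * v' * a) * h"
    if "h * h = polyT a * h + fls_const b" for h :: "'a fls"
  proof -
    have "(polyT u + polyT v * h) * (polyT u' + polyT v' * h)
      = polyT u * polyT u' + (polyT u * polyT v' + polyT v * polyT u') * h + polyT v * polyT v' * (h * h)"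
      by (simp add: algebra_simps)
    then show ?thesis unfolding that
      by (simp add: polyT_add polyT_mult polyT_smult algebra_simps)
  qed
  show ?thesis unfolding 1 2 *[OF ff] *[OF gg] by (rule conj_pair.intros)
qed

lemma conj_pair_const: "conj_pair (fls_const c) (fls_const c)"
  using conj_pair_polyT[of "[:c:]"] by simp

lemma conj_pair_uminus: "conj_pair x y \<Longrightarrow> conj_pair (- x) (- y)"
  using conj_pair_mult[OF conj_pair_const[of "- 1"]] by fastforce

lemma conj_pair_diff: "conj_pair x y \<Longrightarrow> conj_pair x' y' \<Longrightarrow> conj_pair (x - x') (y - y')"
  using conj_pair_add[of x y "- x'" "- y'"] conj_pair_uminus by simp

lemma conj_pair_power: "conj_pair x y \<Longrightarrow> conj_pair (x ^ n) (y ^ n)"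
  using conj_pair_const[of 1] by (induction n) (auto intro: conj_pair_mult)

text \<open>From f g = -b with b a nonzero constant, 1/f = -g/b, which again has polynomial
  coordinates. Division by f therefore stays inside A[f].\<close>

lemma conj_pair_inverse_f: "conj_pair (inverse f) (inverse g)"
proof -
  have "f * (fls_const (- inverse b) * g) = fls_const (- inverse b) * (f * g)"
    by (simp only: ac_simps)
  also have "\<dots> = 1" using b_nonzero by (simp add: f_times_g)
  finally have fg: "f * (fls_const (- inverse b) * g) = 1" .
  then have "g * (fls_const (- inverse b) * f) = 1" by (simp only: ac_simps)
  with fg have "inverse f = fls_const (- inverse b) * g" "inverse g = fls_const (- inverse b) * f"
    using inverse_unique by blast+
  moreover have "conj_pair g f"
    using conj_pair_diff[OF conj_pair_polyT[of a] conj_pair_f] by (simp add: g_def)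
  ultimately show ?thesis using conj_pair_mult conj_pair_const by metis
qed

section \<open>Uniqueness of coordinates and expansion in powers of f\<close>

lemma polyT_coords_unique:
  assumes "polyT u + polyT v * f = polyT u' + polyT v' * f"
  shows "u = u'" "v = v'"
proof -
  have eq: "polyT (v - v') * f = polyT (u' - u)"
    using assms by (simp add: polyT_diff algebra_simps)
  show "v = v'"
  proof (rule ccontr)
    assume "v \<noteq> v'"
    then have "f = polyT (u' - u) / polyT (v - v')" "v - v' \<noteq> 0"
      using eq by (simp_all add: eq_divide_eq mult.commute)
    then have "f \<in> kfield" unfolding kfield_def by blast
    with irrational show False ..
  qed
  then show "u = u'" using eq by simp
qed

text \<open>The difference x - y = v (f - g) has absolute value at least q^d unless v = 0; then x =
  y = u is a polynomial of absolute value below 1. This discreteness ends the expansion below and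
  gives injectivity later.\<close>

lemma conj_pair_small_imp_0:
  assumes "conj_pair x y" "val_ge y 1" "val_ge x (1 - int d)"
  shows "x = 0"
proof -
  from assms(1) obtain u v where xy: "x = polyT u + polyT v * f" "y = polyT u + polyT v * g"
    by cases auto
  have "val_ge (x - y) (1 - int d)"
    using assms(3) val_ge_mono[OF assms(2)] by (intro val_ge_diff) auto
  moreover have "x - y = polyT v * (f - g)" by (simp add: xy algebra_simps)
  moreover have "fls_subdegree (polyT v * (f - g)) = - int (degree v) - int d" if "v \<noteq> 0"
    using fls_subdegree_mult[OF polyT_nth_subdegree(1)[OF that] diff_f_g(1)]
    by (simp add: diff_f_g polyT_nth_subdegree[OF that])
  ultimately have "v = 0"
    using diff_f_g(1) by (cases "v = 0") (auto simp: val_ge_iff)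
  then show ?thesis using assms(2) val_ge_polyT_pos_imp_0[of u] by (simp add: xy)
qed

text \<open>The step of the expansion in powers of \<open>f\<close>: the digit is the polynomial part of \<open>y / g\<close>.\<close>

lemma conj_pair_digit:
  assumes "conj_pair x y" "val_ge y (int d - int i)"
  obtains r z w where "degree r \<le> i" "x = polyT r * f + z * f" "conj_pair z w" "val_ge w 1"
    "z = x * inverse f - polyT r"
proof -
  have "val_ge (inverse g) (- int d)" by (simp add: val_ge_iff)
  then have "val_ge (y * inverse g) (- int i)"
    using val_ge_mult[OF assms(2)] by fastforce
  then obtain r where r: "degree r \<le> i" "val_ge (y * inverse g - polyT r) 1"
    by (rule polynomial_part)
  show thesis
  proof
    show "x = polyT r * f + (x * inverse f - polyT r) * f" by (simp add: field_simps)
    show "conj_pair (x * inverse f - polyT r) (y * inverse g - polyT r)"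
      by (intro conj_pair_diff conj_pair_mult assms conj_pair_inverse_f conj_pair_polyT)
  qed (use r in auto)
qed

text \<open>Each step removes a digit and divides by f, lowering the bound on |x| by the factor q^d
  while the choice of digit keeps |y| < 1. At n = 0 the bound is that of
  \<open>conj_pair_small_imp_0\<close>.\<close>

lemma conj_pair_expansion:
  assumes "conj_pair x y" "val_ge y 1" "val_ge x (1 - int ((n + 1) * d))"
  obtains c where "\<And>i. degree (c i) \<le> d - 1" "x = (\<Sum>i=1..n. polyT (c i) * f ^ i)"
  using assms
proof (induction n arbitrary: x y thesis)
  case 0
  then have "x = 0" by (intro conj_pair_small_imp_0) auto
  then show ?case using "0.prems"(1)[of "\<lambda>_. 0"] by simp
next
  case (Suc n)
  \<comment> \<open>With i = d - 1 the hypothesis of \<open>conj_pair_digit\<close> is exactly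
    \<open>val_ge y 1\<close>, and the digit has degree at most d - 1.\<close>
  obtain r z w where r: "degree r \<le> d - 1" and x: "x = polyT r * f + z * f"
    and zw: "conj_pair z w" "val_ge w 1" and z: "z = x * inverse f - polyT r"
    using conj_pair_digit[OF Suc.prems(2), of "d - 1"] Suc.prems(3) deg_pos by (auto simp: of_nat_diff)
  have "val_ge (x * inverse f) (1 - int ((Suc n + 1) * d) + int d)"
    by (intro val_ge_mult Suc.prems) (simp add: val_ge_iff)
  then have "val_ge (x * inverse f) (1 - int ((n + 1) * d))"
    by (simp add: algebra_simps)
  moreover have "val_ge (polyT r) (1 - int ((n + 1) * d))"
  proof (rule val_ge_mono)
    show "val_ge (polyT r) (- int (d - 1))" using r by (simp only: val_ge_polyT_iff)
    show "1 - int ((n + 1) * d) \<le> - int (d - 1)"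
      using deg_pos by (simp add: of_nat_diff algebra_simps)
  qed
  ultimately have "val_ge z (1 - int ((n + 1) * d))"
    unfolding z by (rule val_ge_diff)
  from Suc.IH[OF _ zw this] obtain c where
    c: "\<And>i. degree (c i) \<le> d - 1" "z = (\<Sum>i=1..n. polyT (c i) * f ^ i)" by blast
  define c' where "c' i = (if i = 1 then r else c (i - 1))" for i
  have "(\<Sum>i=1..Suc n. polyT (c' i) * f ^ i) = polyT r * f + (\<Sum>i=Suc 1..Suc n. polyT (c' i) * f ^ i)"
    by (subst sum.atLeast_Suc_atMost) (simp_all add: c'_def)
  also have "(\<Sum>i=Suc 1..Suc n. polyT (c' i) * f ^ i) = (\<Sum>i=1..n. polyT (c i) * f ^ Suc i)"
    unfolding sum.shift_bounds_cl_Suc_ivl by (intro sum.cong) (simp_all add: c'_def)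
  also have "\<dots> = z * f" unfolding c(2) sum_distrib_right by (intro sum.cong) (simp_all add: ac_simps)
  finally show ?case using r c(1) x by (intro Suc.prems(1)[of c']) (auto simp: c'_def)
qed

section \<open>The ideals and their monic elements\<close>

lemma Ainf1_sum:
  assumes "\<And>j. j \<in> A \<Longrightarrow> h j \<in> Ainf1 f d"
  shows "sum h A \<in> Ainf1 f d"
  using assms
proof (induction A rule: infinite_finite_induct)
  case (insert j A)
  then show ?case by (simp add: Ainf1.add)
qed (use Ainf1.const[of 0] in auto)

lemma polyT_times_f_in_Ainf1:
  assumes "degree c \<le> d - 1"
  shows "polyT c * f \<in> Ainf1 f d"
proof -
  have "polyT c * f = (\<Sum>j\<le>degree c. fls_const (coeff c j) * (f * TT ^ j))"
    unfolding polyT_eq_sum[of c] sum_distrib_right by (intro sum.cong) (simp_all add: ac_simps)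
  also have "\<dots> \<in> Ainf1 f d"
    using assms deg_pos by (intro Ainf1_sum Ainf1.mult Ainf1.const Ainf1.gen) auto
  finally show ?thesis .
qed

lemma f_in_Ainf1: "f \<in> Ainf1 f d"
  using polyT_times_f_in_Ainf1[of 1] by simp

lemma f_power_in_Ainf1: "f ^ n \<in> Ainf1 f d"
  by (induction n) (use Ainf1.const[of 1] f_in_Ainf1 in \<open>auto intro: Ainf1.mult\<close>)

lemma val_ge_bound_exists:
  obtains n :: nat where "val_ge x (1 - int ((n + 1) * d))"
proof
  have "int (nat (- fls_subdegree x) + 1) \<le> int ((nat (- fls_subdegree x) + 1) * d)"
    using mult_le_mono2[OF deg_pos, of "nat (- fls_subdegree x) + 1"]
    by (simp only: of_nat_le_iff mult_1_right)
  then show "val_ge x (1 - int ((nat (- fls_subdegree x) + 1) * d))"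
    unfolding val_ge_iff by linarith
qed

lemma conj_pair_in_Ainf1:
  assumes "conj_pair x y" "val_ge y 1"
  shows "x \<in> Ainf1 f d"
proof -
  obtain n where "val_ge x (1 - int ((n + 1) * d))" by (rule val_ge_bound_exists)
  from conj_pair_expansion[OF assms this] obtain c where
    c: "\<And>i. degree (c i) \<le> d - 1" "x = (\<Sum>i=1..n. polyT (c i) * f ^ i)" by blast
  have "polyT (c i) * f ^ i \<in> Ainf1 f d" if "i \<in> {1..n}" for i
  proof -
    have "polyT (c i) * f ^ i = polyT (c i) * f * f ^ (i - 1)"
      using that by (cases i) auto
    also have "\<dots> \<in> Ainf1 f d"
      by (intro Ainf1.mult polyT_times_f_in_Ainf1 c f_power_in_Ainf1)
    finally show ?thesis .
  qed
  then show ?thesis unfolding c(2) by (rule Ainf1_sum)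
qed

lemma TT_power_eq_polyT: "TT ^ i = polyT (monom 1 i)"
  by (induction i) (auto simp: monom_Suc polyT_pCons)

lemma conj_pair_f_TT: "conj_pair (f * TT ^ i) (g * TT ^ i)"
  using conj_pair_mult[OF conj_pair_f conj_pair_polyT[of "monom 1 i"]]
  by (simp add: TT_power_eq_polyT)

lemma conj_pair_sum:
  assumes "\<And>j. j \<in> A \<Longrightarrow> conj_pair (r j) (s j)"
  shows "conj_pair (sum r A) (sum s A)"
  using assms
proof (induction A rule: infinite_finite_induct)
  case (insert j A)
  then show ?case by (simp add: conj_pair_add)
qed (use conj_pair_const[of 0] in auto)

text \<open>Regularity away from the first place at infinity bounds the conjugate by 1 at the
  second: the generators f T^j have conjugates g T^j of valuation d - j > 0, and the bound survives
  sums and products.\<close>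

lemma Ainf1_imp_conj_pair:
  assumes "x \<in> Ainf1 f d"
  shows "\<exists>y. conj_pair x y \<and> val_ge y 0"
  using assms
proof induction
  case (const c)
  then show ?case using conj_pair_const[of c] by (intro exI[of _ "fls_const c"]) (simp add: val_ge_iff)
next
  case (gen i)
  then have "val_ge (g * TT ^ i) 0" by (simp add: val_ge_iff TT_def)
  then show ?case using conj_pair_f_TT by blast
next
  case (add x x')
  then show ?case by (meson conj_pair_add val_ge_add)
next
  case (neg x)
  then show ?case by (meson conj_pair_uminus val_ge_uminus)
next
  case (mult x x')
  then show ?case using conj_pair_mult val_ge_mult by (metis add_0)
qed

text \<open>The generators f T^j with j \<le> i have conjugates of valuation d - j \<ge> d - i.
  Conversely, a single digit of degree at most i is a constant combination of these generators, up
  to a multiple of f by a ring element.\<close>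

lemma ideal_a_eq:
  assumes "i < d"
  shows "ideal_a f d i = {x. \<exists>y. conj_pair x y \<and> val_ge y (int d - int i)}"
proof (intro equalityI subsetI CollectI)
  fix x assume "x \<in> ideal_a f d i"
  then obtain r where r: "\<And>j. j \<le> i \<Longrightarrow> r j \<in> Ainf1 f d" and x: "x = (\<Sum>j\<le>i. r j * (f * TT ^ j))"
    by (auto simp: ideal_a_def)
  obtain s where s: "\<And>j. j \<le> i \<Longrightarrow> conj_pair (r j) (s j) \<and> val_ge (s j) 0"
    using Ainf1_imp_conj_pair[OF r] by metis
  have "conj_pair (\<Sum>j\<le>i. r j * (f * TT ^ j)) (\<Sum>j\<le>i. s j * (g * TT ^ j))"
    using s by (intro conj_pair_sum conj_pair_mult conj_pair_f_TT) auto
  moreover have "val_ge (\<Sum>j\<le>i. s j * (g * TT ^ j)) (int d - int i)"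
  proof (rule val_ge_sum)
    fix j assume "j \<in> {..i}"
    then have "val_ge (g * TT ^ j) (int d - int i)" by (simp add: val_ge_iff TT_def)
    then show "val_ge (s j * (g * TT ^ j)) (int d - int i)"
      using val_ge_mult[of "s j" 0] s \<open>j \<in> {..i}\<close> by fastforce
  qed
  ultimately show "\<exists>y. conj_pair x y \<and> val_ge y (int d - int i)" unfolding x by blast
next
  fix x assume "x \<in> {x. \<exists>y. conj_pair x y \<and> val_ge y (int d - int i)}"
  then obtain y where y: "conj_pair x y" "val_ge y (int d - int i)" by auto
  obtain r z w where r: "degree r \<le> i" and x: "x = polyT r * f + z * f"
    and zw: "conj_pair z w" "val_ge w 1"
    using conj_pair_digit[OF y] by metis
  \<comment> \<open>The coefficients of the digit r are the multipliers of the f T^j; the remaining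
    term z f is absorbed by the generator f, at j = 0.\<close>
  define R where "R j = fls_const (coeff r j) + (if j = 0 then z else 0)" for j
  have "polyT r = (\<Sum>j\<le>i. fls_const (coeff r j) * TT ^ j)"
    unfolding polyT_eq_sum using r
    by (intro sum.mono_neutral_left) (auto simp: coeff_eq_0)
  then have "x = (\<Sum>j\<le>i. fls_const (coeff r j) * (f * TT ^ j)) + z * f"
    unfolding x by (simp add: sum_distrib_left mult.commute[of _ f] mult.left_commute[of _ f])
  also have "z * f = (\<Sum>j\<le>i. (if j = 0 then z else 0) * (f * TT ^ j))"
    by (simp add: if_distrib[of "\<lambda>u. u * _"] cong: if_cong)
  finally have "x = (\<Sum>j\<le>i. R j * (f * TT ^ j))"
    by (simp add: R_def distrib_right sum.distrib)
  moreover have "R j \<in> Ainf1 f d" for j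
    using conj_pair_in_Ainf1[OF zw] Ainf1.const[of "coeff r j"] by (auto simp: R_def intro: Ainf1.add)
  ultimately show "x \<in> ideal_a f d i" unfolding ideal_a_def by (intro CollectI exI[of _ R]) simp
qed

text \<open>As the digits have degree below d, a term c_i f^i with i < k has degree less than (i +
  1) d \<le> k d, so the top term dominates. Its leading coefficient is that of c_k because f has
  leading coefficient 1.\<close>

lemma lead_expansion:
  fixes c0 :: 'a
  assumes deg: "\<And>i. i \<in> {1..k} \<Longrightarrow> degree (c i) \<le> d - 1"
    and k: "k \<ge> 1" "c k \<noteq> 0"
  defines "x \<equiv> fls_const c0 + (\<Sum>i=1..k. polyT (c i) * f ^ i)"
  shows "x \<noteq> 0" "x $$ fls_subdegree x = lead_coeff (c k)"
proof -
  define t where "t = polyT (c k) * f ^ k"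
  define e where "e = fls_const c0 + (\<Sum>i=1..<k. polyT (c i) * f ^ i)"
  have "{1..k} = insert k {1..<k}" using k by auto
  then have x: "x = t + e" by (simp add: x_def t_def e_def)
  have t0: "t \<noteq> 0" using k by (simp add: t_def)
  have sdt: "fls_subdegree t = - int (degree (c k)) - int k * int d"
    using k by (simp add: t_def polyT_nth_subdegree fls_subdegree_pow)
  have leadt: "t $$ fls_subdegree t = lead_coeff (c k)"
    unfolding t_def using k
    by (subst lead_mult, simp, simp, subst lead_power) (simp_all add: lead_f polyT_nth_subdegree(3) del: polyT_eq_0_iff)
  have "val_ge e (1 - int k * int d)"
    unfolding e_def
  proof (intro val_ge_add val_ge_sum)
    have "int k * int d \<ge> 1 * 1" using k deg_pos by (intro mult_mono) auto
    then show "val_ge (fls_const c0) (1 - int k * int d)" by (simp add: val_ge_iff)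
  next
    fix i assume i: "i \<in> {1..<k}"
    have "val_ge (polyT (c i)) (- int (d - 1))"
      using deg[of i] i by (simp only: val_ge_polyT_iff) auto
    moreover have "val_ge (f ^ i) (- (int i * int d))"
      by (simp add: val_ge_iff fls_subdegree_pow)
    ultimately have "val_ge (polyT (c i) * f ^ i) (- int (d - 1) + - (int i * int d))"
      by (rule val_ge_mult)
    moreover have "(int i + 1) * int d \<le> int k * int d"
      using i by (intro mult_right_mono) auto
    ultimately show "val_ge (polyT (c i) * f ^ i) (1 - int k * int d)"
      using deg_pos by (elim val_ge_mono) (auto simp: of_nat_diff algebra_simps)
  qed
  moreover have "fls_subdegree t < 1 - int k * int d" by (simp add: sdt)
  ultimately show "x \<noteq> 0" "x $$ fls_subdegree x = lead_coeff (c k)"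
    unfolding x using subdegree_add_val_ge[OF t0] leadt by auto
qed

text \<open>This replaces the definition by digits with a multiplicative condition on the leading
  coefficient, which can be carried through multiplication by powers of f.\<close>

lemma monicA_iff_lead:
  assumes "conj_pair x y" "val_ge y 1" "x \<noteq> 0"
  shows "monicA f d x \<longleftrightarrow> x $$ fls_subdegree x = 1"
proof
  assume "monicA f d x"
  then show "x $$ fls_subdegree x = 1"
    unfolding monicA_def
  proof (elim disjE exE conjE)
    fix c0 c k
    assume *: "1 \<le> k" "\<forall>i\<in>{1..k}. degree (c i) \<le> d - 1" "lead_coeff (c k) = 1"
      "x = fls_const c0 + (\<Sum>i=1..k. polyT (c i) * f ^ i)"
    then have "c k \<noteq> 0" by auto
    with * show ?thesis using lead_expansion(2)[of k c c0] by simp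
  qed simp
next
  assume lead: "x $$ fls_subdegree x = 1"
  obtain n where "val_ge x (1 - int ((n + 1) * d))" by (rule val_ge_bound_exists)
  from conj_pair_expansion[OF assms(1,2) this] obtain c where
    c: "\<And>i. degree (c i) \<le> d - 1" "x = (\<Sum>i=1..n. polyT (c i) * f ^ i)" by blast
  define I where "I = {i \<in> {1..n}. c i \<noteq> 0}"
  have "I \<noteq> {}" using assms(3) c(2) by (auto simp: I_def intro: sum.neutral)
  moreover have "finite I" by (simp add: I_def)
  ultimately obtain k where k: "k \<in> I" "\<And>i. i \<in> I \<Longrightarrow> i \<le> k"
    using Max_in Max_ge by metis
  have gt: "c i = 0" if "i \<in> {1..n} - {1..k}" for i
    using that k(2)[of i] by (auto simp: I_def)
  \<comment> \<open>Because |y| < 1 the expansion has no constant term, so c0 = 0; digits above the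
    top nonzero index k are dropped.\<close>
  have "x = fls_const 0 + (\<Sum>i=1..k. polyT (c i) * f ^ i)"
    unfolding c(2) fls_const_0 add_0_left
  proof (rule sum.mono_neutral_right)
    show "{1..k} \<subseteq> {1..n}" using k(1) by (auto simp: I_def)
    show "\<forall>i\<in>{1..n} - {1..k}. polyT (c i) * f ^ i = 0" using gt by (metis mult_zero_left polyT_0)
  qed simp
  moreover have "1 \<le> k" "c k \<noteq> 0" using k(1) by (auto simp: I_def)
  moreover from calculation have "lead_coeff (c k) = 1"
    using lead_expansion(2)[of k c 0] c(1) lead by simp
  ultimately show "monicA f d x"
    unfolding monicA_def using c(1) by blast
qed

section \<open>Zeta values\<close>

definition monics :: "nat \<Rightarrow> 'a fls set" where
  "monics i = {x \<in> ideal_a f d i. x \<noteq> 0 \<and> monicA f d x}"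

lemma monicsD:
  assumes "i < d" "x \<in> monics i"
  obtains y where "conj_pair x y" "val_ge y (int d - int i)" "val_ge y 1"
    "x \<noteq> 0" "x $$ fls_subdegree x = 1" "fls_subdegree x \<le> - int d"
proof -
  from assms obtain y where y: "conj_pair x y" "val_ge y (int d - int i)" "x \<noteq> 0"
    by (auto simp: monics_def ideal_a_eq)
  have y1: "val_ge y 1" using y(2) assms(1) by (elim val_ge_mono) auto
  moreover have "x $$ fls_subdegree x = 1"
    using monicA_iff_lead[OF y(1) y1 y(3)] assms(2) by (simp add: monics_def)
  moreover have "fls_subdegree x \<le> - int d"
    using conj_pair_small_imp_0[OF y(1) y1] y(3) by (force simp: val_ge_iff)
  ultimately show thesis using y that by blast
qed

lemma monicsI:
  assumes "i < d" "conj_pair x y" "val_ge y (int d - int i)" "x \<noteq> 0" "x $$ fls_subdegree x = 1"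
  shows "x \<in> monics i"
proof -
  have "val_ge y 1" using assms(1,3) by (elim val_ge_mono) auto
  then show ?thesis using assms monicA_iff_lead by (auto simp: monics_def ideal_a_eq)
qed

text \<open>Bounds on x and on its conjugate y bound both coordinates, through v = (x - y)/(f - g)
  and u = y - v g, and there are finitely many polynomials of bounded degree.\<close>

lemma finite_bounded_monics:
  assumes "i < d"
  shows "finite {x \<in> monics i. val_ge x (- int n)}"
proof (rule finite_subset)
  let ?P = "{p :: 'a poly. degree p \<le> n}"
  show "finite ((\<lambda>(u, v). polyT u + polyT v * f) ` (?P \<times> ?P))"
    by (intro finite_imageI finite_cartesian_product finite_degree_le)
  show "{x \<in> monics i. val_ge x (- int n)} \<subseteq> (\<lambda>(u, v). polyT u + polyT v * f) ` (?P \<times> ?P)"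
  proof clarify
    fix x assume x: "x \<in> monics i" "val_ge x (- int n)"
    from monicsD[OF assms x(1)] obtain y where y: "conj_pair x y" "val_ge y 1" by metis
    from y(1) obtain u v where uv: "x = polyT u + polyT v * f" "y = polyT u + polyT v * g"
      by cases auto
    have yn: "val_ge y (- int n)" using y(2) by (rule val_ge_mono) simp
    have "polyT v = (x - y) * inverse (f - g)"
      using diff_f_g(1) by (simp add: uv field_simps)
    moreover have "val_ge (inverse (f - g)) 0" using diff_f_g by (simp add: val_ge_iff)
    ultimately have v: "val_ge (polyT v) (- int n)"
      using val_ge_mult[OF val_ge_diff[OF x(2) yn]] by fastforce
    have "val_ge (polyT v * g) (- int n + 0)"
      by (intro val_ge_mult v) (simp add: val_ge_iff)
    then have "val_ge (polyT u) (- int n)"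
      using val_ge_diff[OF yn, of "polyT v * g"] by (simp add: uv)
    with v show "x \<in> (\<lambda>(u, v). polyT u + polyT v * f) ` (?P \<times> ?P)"
      unfolding val_ge_polyT_iff uv(1) by (intro image_eqI[of _ _ "(u, v)"]) auto
  qed
qed

text \<open>Allowing any h that preserves valuations covers the zeta sum of the ideal (h the
  identity) as well as its perturbation coming from \<Lambda>.\<close>

lemma summable_inverse_power:
  fixes h :: "'a fls \<Rightarrow> 'a fls"
  assumes "i < d" "m \<ge> 1" "\<And>x. x \<in> monics i \<Longrightarrow> h x \<noteq> 0 \<and> fls_subdegree (h x) = fls_subdegree x"
  shows "(\<lambda>x. inverse (h x) ^ m) summable_on monics i"
proof -
  have *: "val_ge x (- int (nat n))" if x: "x \<in> monics i" "\<not> val_ge (inverse (h x) ^ m) n" for x n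
  proof -
    have "fls_subdegree x \<le> 0" using monicsD[OF assms(1) x(1)] by force
    moreover have "int m * - fls_subdegree x < n"
    proof -
      have "fls_subdegree (inverse (h x) ^ m) = int m * - fls_subdegree x"
        using assms(3)[OF x(1)] by (simp only: fls_subdegree_pow fls_inverse_subdegree)
      then show ?thesis using x(2) unfolding val_ge_iff by linarith
    qed
    moreover have "1 * - fls_subdegree x \<le> int m * - fls_subdegree x"
      using assms(2) calculation(1) by (intro mult_right_mono) auto
    ultimately show ?thesis by (simp add: val_ge_iff)
  qed
  show ?thesis
    by (rule summable_on_fls, rule finite_subset[OF _ finite_bounded_monics[OF assms(1)]])
      (use * in blast)
qed

abbreviation zeta_monics :: "nat \<Rightarrow> nat \<Rightarrow> 'a fls" where
  "zeta_monics i m \<equiv> (\<Sum>\<^sub>\<infinity>x\<in>monics i. inverse x ^ m)"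

text \<open>The generator \<open>f\<close> is the only monic element of minimal absolute value,
  so its term dominates the sum.\<close>

lemma zeta_monics_nonzero:
  assumes "i < d" "m \<ge> 1"
  shows "zeta_monics i m \<noteq> 0"
proof -
  have f: "f \<in> monics i"
    using assms(1) by (intro monicsI[OF _ conj_pair_f]) (auto simp: lead_f val_ge_iff)
  have "((\<lambda>x. if x = f then inverse f ^ m else 0) has_sum inverse f ^ m) (monics i)"
  proof -
    have "((\<lambda>x. if x = f then inverse f ^ m else 0) has_sum inverse f ^ m) {f}"
      by (rule has_sum_finiteI) auto
    then show ?thesis
      by (rule has_sum_cong_neutral[THEN iffD1, rotated -1]) (use f in auto)
  qed
  moreover have "((\<lambda>x. inverse x ^ m) has_sum zeta_monics i m) (monics i)"
    using summable_inverse_power[OF assms, of "\<lambda>x. x"] monicsD[OF assms(1)]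
    by (intro has_sum_infsum) blast
  moreover have "val_ge ((if x = f then inverse f ^ m else 0) - inverse x ^ m) (int m * int d + 1)"
    if x: "x \<in> monics i" for x
  proof (cases "x = f")
    case False
    from monicsD[OF assms(1) x] obtain y where y: "conj_pair x y" "val_ge y 1"
      "x \<noteq> 0" "x $$ fls_subdegree x = 1" "fls_subdegree x \<le> - int d" by metis
    have "fls_subdegree x \<noteq> - int d"
    proof
      \<comment> \<open>Two elements of minimal absolute value q^d with leading coefficient 1 differ
        by an element of smaller absolute value whose conjugate is below 1, hence by 0.\<close>
      assume sd: "fls_subdegree x = - int d"
      have "val_ge (x - f) (1 - int d)"
        unfolding val_ge_def
      proof (intro allI impI)
        fix k assume "k < 1 - int d"
        then consider "k < - int d" | "k = - int d" by linarith
        then show "(x - f) $$ k = 0"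
          using y(4) by cases (simp_all add: sd lead_f)
      qed
      moreover have "val_ge (y - g) 1"
        using deg_pos by (intro val_ge_diff y) (simp add: val_ge_iff)
      ultimately have "x - f = 0"
        using conj_pair_small_imp_0 conj_pair_diff[OF y(1) conj_pair_f] by blast
      then show False using False by simp
    qed
    then have "val_ge (inverse x) (int d + 1)" using y(3,5) by (simp add: val_ge_iff)
    then have "val_ge (inverse x ^ m) (int m * (int d + 1))" by (rule val_ge_power)
    then have "val_ge (inverse x ^ m) (int m * int d + 1)"
      by (rule val_ge_mono) (use assms(2) in \<open>simp add: algebra_simps\<close>)
    then show ?thesis using False by simp
  qed simp
  ultimately have "val_ge (inverse f ^ m - zeta_monics i m) (int m * int d + 1)"
    by (rule has_sum_fls_close)
  then show ?thesis by (auto simp: val_ge_iff fls_subdegree_pow)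
qed

section \<open>Comparison of the approximating polynomials with the ideals\<close>

definition coord :: "'a fls \<Rightarrow> 'a poly" where
  "coord x = (THE v. \<exists>u. x = polyT u + polyT v * f)"

lemma coord_eq: "coord (polyT u + polyT v * f) = v"
  unfolding coord_def by (rule the_equality) (auto dest: polyT_coords_unique)

lemma polyT_coord:
  assumes "conj_pair x y"
  shows "polyT (coord x) * (f - g) = x - y"
proof -
  from assms obtain u v where uv: "x = polyT u + polyT v * f" "y = polyT u + polyT v * g"
    by cases auto
  show ?thesis unfolding uv coord_eq by (simp add: algebra_simps)
qed

definition Lam :: "int \<Rightarrow> 'a poly set" where
  "Lam M = {lam. lam \<noteq> 0 \<and> lead_coeff lam = 1 \<and> (\<exists>u. val_ge (polyT u + polyT lam * g) M)}"

lemma Lambda_eps_monic_eq: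
  assumes "real CARD('a) powr - real_of_int M < \<epsilon>" "\<epsilon> \<le> real CARD('a) powr (1 - real_of_int M)"
  shows "{lam \<in> Lambda_eps f \<epsilon>. lam \<noteq> 0 \<and> lead_coeff lam = 1} = Lam M"
proof -
  have "distA (polyT lam * f) < \<epsilon> \<longleftrightarrow> (\<exists>u. val_ge (polyT u + polyT lam * g) M)" for lam
  proof -
    \<comment> \<open>Since g = a - f, approximating \<lambda> f by p is the same as approximating
      -\<lambda> g by u = p - \<lambda> a; as p varies, u runs over all polynomials.\<close>
    have eq: "polyT (p - lam * a) + polyT lam * g = - (polyT lam * f - polyT p)" for p
      by (simp add: g_def polyT_diff polyT_mult algebra_simps)
    have "distA (polyT lam * f) < \<epsilon> \<longleftrightarrow> (\<exists>p. val_ge (polyT lam * f - polyT p) M)"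
      unfolding distA_less_iff absv_less_iff[OF assms] ..
    also have "\<dots> \<longleftrightarrow> (\<exists>p. val_ge (polyT (p - lam * a) + polyT lam * g) M)"
      unfolding eq val_ge_uminus ..
    also have "\<dots> \<longleftrightarrow> (\<exists>u. val_ge (polyT u + polyT lam * g) M)"
      by (metis add_diff_cancel)
    finally show ?thesis .
  qed
  then show ?thesis by (auto simp: Lambda_eps_def Lam_def)
qed

lemma lead_f_power_mult:
  assumes "x \<noteq> 0"
  shows "(x * f ^ N) $$ fls_subdegree (x * f ^ N) = x $$ fls_subdegree x"
  using assms lead_mult[of x "f ^ N"] lead_power[of f N]
  by (simp add: lead_f del: fls_subdegree_mult)

lemma lead_f_inverse_power_mult:
  assumes "x \<noteq> 0"
  shows "(x * inverse f ^ N) $$ fls_subdegree (x * inverse f ^ N) = x $$ fls_subdegree x"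
  using lead_f_power_mult[of "x * inverse f ^ N" N] assms
  by (simp add: mult.assoc flip: power_mult_distrib)

lemma lead_mult_diff_f_g:
  assumes "v \<noteq> 0"
  shows "(polyT v * (f - g)) $$ fls_subdegree (polyT v * (f - g)) = lead_coeff v"
    "fls_subdegree (polyT v * (f - g)) \<le> - int d"
proof -
  note v = polyT_nth_subdegree[OF assms]
  have "(polyT v * (f - g)) $$ fls_subdegree (polyT v * (f - g)) = lead_coeff v * 1"
    unfolding lead_mult[OF v(1) diff_f_g(1)] v(3) diff_f_g(2,3) ..
  then show "(polyT v * (f - g)) $$ fls_subdegree (polyT v * (f - g)) = lead_coeff v" by simp
  show "fls_subdegree (polyT v * (f - g)) \<le> - int d"
    unfolding fls_subdegree_mult[OF v(1) diff_f_g(1)] v(2) diff_f_g(2) by simp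
qed

text \<open>Multiplication by (f, g)^N raises the valuation of the conjugate by N d, from d - i to
  (N + 1) d - i, and is invertible because f is a unit. Taking the coordinate of f then turns a pair
  into its polynomial \<lambda>.\<close>

lemma bij_betw_coord:
  assumes i: "i < d"
  shows "bij_betw (\<lambda>x. coord (x * f ^ N)) (monics i) (Lam (int (N + 1) * int d - int i))"
proof -
  let ?M = "int (N + 1) * int d - int i"
  have "?M = int N * int d + (int d - int i)" by (simp add: algebra_simps)
  moreover have "int N * int d \<ge> 0" by simp
  ultimately have M_pos: "1 \<le> ?M" using i by linarith
  have M1: "val_ge z ?M \<Longrightarrow> val_ge z 1" for z :: "'a fls"
    using M_pos by (rule val_ge_mono[rotated])
  have gN: "val_ge (y * g ^ N) ?M" if "val_ge y (int d - int i)" for y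
    using val_ge_mult[OF that, of "g ^ N" "int N * int d"]
    by (simp add: val_ge_iff fls_subdegree_pow algebra_simps)
  show ?thesis
    unfolding bij_betw_def
  proof (intro conjI inj_onI equalityI subsetI)
    fix x x' assume x: "x \<in> monics i" "x' \<in> monics i" and eq: "coord (x * f ^ N) = coord (x' * f ^ N)"
    from monicsD[OF i x(1)] obtain y where y: "conj_pair x y" "val_ge y (int d - int i)" by metis
    from monicsD[OF i x(2)] obtain y' where y': "conj_pair x' y'" "val_ge y' (int d - int i)" by metis
    have "x * f ^ N - y * g ^ N = x' * f ^ N - y' * g ^ N"
      using eq polyT_coord conj_pair_mult[OF _ conj_pair_power[OF conj_pair_f]] y(1) y'(1) by metis
    \<comment> \<open>Equal coordinates give a difference pair with equal components; the second is
      below 1, so the first is small enough to vanish.\<close>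
    then have "x * f ^ N - x' * f ^ N = y * g ^ N - y' * g ^ N" by (simp add: algebra_simps)
    moreover have "val_ge (y * g ^ N - y' * g ^ N) 1" by (intro M1 val_ge_diff gN y y')
    moreover have "conj_pair (x * f ^ N - x' * f ^ N) (y * g ^ N - y' * g ^ N)"
      by (intro conj_pair_diff conj_pair_mult conj_pair_power conj_pair_f y y')
    ultimately have "x * f ^ N - x' * f ^ N = 0"
      by (intro conj_pair_small_imp_0) (auto elim: val_ge_mono)
    then show "x = x'" by simp
  next
    fix lam assume "lam \<in> (\<lambda>x. coord (x * f ^ N)) ` monics i"
    then obtain x where x: "x \<in> monics i" and lam: "lam = coord (x * f ^ N)" by auto
    from monicsD[OF i x] obtain y where y: "conj_pair x y" "val_ge y (int d - int i)"
      "x \<noteq> 0" "x $$ fls_subdegree x = 1" "fls_subdegree x \<le> - int d" by metis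
    have pair: "conj_pair (x * f ^ N) (y * g ^ N)"
      by (intro conj_pair_mult conj_pair_power conj_pair_f y)
    then obtain u v where uv: "x * f ^ N = polyT u + polyT v * f" "y * g ^ N = polyT u + polyT v * g"
      by cases auto
    have lamv: "lam = v" by (simp add: lam uv(1) coord_eq)
    have "fls_subdegree (x * f ^ N) < ?M"
    proof -
      have "int N * int d \<ge> 0" by simp
      then have "fls_subdegree x \<le> int N * int d" using y(5) by linarith
      then have "fls_subdegree (x * f ^ N) \<le> 0" using y(3) by (simp add: fls_subdegree_pow)
      with M_pos show ?thesis by linarith
    qed
    \<comment> \<open>Monicity transfers because y g^N is negligible: x f^N and v (f - g) share
      their leading coefficient.\<close>
    with subdegree_add_val_ge[of "x * f ^ N" "- (y * g ^ N)" ?M] gN[OF y(2)]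
    have "x * f ^ N - y * g ^ N \<noteq> 0"
      "(x * f ^ N - y * g ^ N) $$ fls_subdegree (x * f ^ N - y * g ^ N) = 1"
      using y(3,4) lead_f_power_mult[OF y(3), of N] by (simp_all del: fls_subdegree_mult)
    moreover have "x * f ^ N - y * g ^ N = polyT v * (f - g)"
      using polyT_coord[OF pair] lam lamv by simp
    ultimately have "v \<noteq> 0" "lead_coeff v = 1"
      using lead_mult_diff_f_g[of v] by auto
    then show "lam \<in> Lam ?M" using gN[OF y(2)] by (auto simp: Lam_def lamv uv(2))
  next
    fix lam assume "lam \<in> Lam ?M"
    then obtain u where lam: "lam \<noteq> 0" "lead_coeff lam = 1" "val_ge (polyT u + polyT lam * g) ?M"
      by (auto simp: Lam_def)
    define X where "X = polyT u + polyT lam * f"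
    define Y where "Y = polyT u + polyT lam * g"
    have YM: "val_ge Y ?M" using lam by (simp add: Y_def)
    have X: "X = polyT lam * (f - g) + Y" by (simp add: X_def Y_def algebra_simps)
    have X0: "X \<noteq> 0" "X $$ fls_subdegree X = 1"
      using subdegree_add_val_ge[OF _ M1[OF YM], of "polyT lam * (f - g)"]
        lead_mult_diff_f_g[OF lam(1)] lam(1,2) diff_f_g(1) unfolding X by (auto simp del: fls_subdegree_mult)
    have "X * inverse f ^ N \<in> monics i"
    proof (rule monicsI[OF i])
      show "conj_pair (X * inverse f ^ N) (Y * inverse g ^ N)"
        unfolding X_def Y_def
        by (intro conj_pair_mult conj_pair_power conj_pair_inverse_f conj_pair.intros)
      show "val_ge (Y * inverse g ^ N) (int d - int i)"
        using val_ge_mult[OF YM, of "inverse g ^ N" "- (int N * int d)"]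
        by (simp add: val_ge_iff fls_subdegree_pow algebra_simps)
    qed (use X0 lead_f_inverse_power_mult[OF X0(1)] in auto)
    moreover have "lam = coord (X * inverse f ^ N * f ^ N)"
      by (simp add: mult.assoc coord_eq X_def flip: power_mult_distrib)
    ultimately show "lam \<in> (\<lambda>x. coord (x * f ^ N)) ` monics i" by blast
  qed
qed

text \<open>Chosen so that \<lambda> / \<open>scale N\<close> = \<lambda> (f - g) / f^N is close to
  the element x of the ideal that corresponds to \<lambda>.\<close>

definition scale :: "nat \<Rightarrow> 'a fls" where "scale N = f ^ N * inverse (f - g)"

lemma scale_nonzero: "scale N \<noteq> 0"
  using diff_f_g(1) by (simp add: scale_def)

text \<open>After reindexing over the ideal, the rescaled term is the inverse power of h x = x - y
  (g/f)^N, where |y| < 1 and |g/f| < 1. The terms agree uniformly up to valuation N, hence so do the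
  sums.\<close>

lemma zeta_eps_approx:
  assumes i: "i < d" and "m \<ge> 1"
    and eps: "real CARD('a) powr - real_of_int (int (N + 1) * int d - int i) < \<epsilon>"
      "\<epsilon> \<le> real CARD('a) powr (1 - real_of_int (int (N + 1) * int d - int i))"
  shows "val_ge (scale N ^ m * zeta_eps f \<epsilon> m - zeta_monics i m) (int N)"
proof -
  define h where "h x = polyT (coord (x * f ^ N)) * inverse (scale N)" for x
  have h: "val_ge (h x - x) (int N)" "h x \<noteq> 0" "fls_subdegree (h x) = fls_subdegree x"
    if x: "x \<in> monics i" for x
  proof -
    from monicsD[OF i x] obtain y where y: "conj_pair x y" "val_ge y 1"
      "x \<noteq> 0" "fls_subdegree x \<le> - int d" by metis
    have "polyT (coord (x * f ^ N)) * (f - g) = x * f ^ N - y * g ^ N"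
      by (intro polyT_coord conj_pair_mult conj_pair_power conj_pair_f y)
    then have "h x = (x * f ^ N - y * g ^ N) * inverse f ^ N"
      using diff_f_g(1) by (simp add: h_def scale_def field_simps)
    also have "\<dots> = x - y * (g * inverse f) ^ N"
      by (simp add: power_mult_distrib left_diff_distrib mult.assoc flip: power_mult_distrib[of f "inverse f"])
    finally have hx: "h x = x + - (y * (g * inverse f) ^ N)" by simp
    have "val_ge (g * inverse f) 1" using deg_pos by (simp add: val_ge_iff)
    from val_ge_power[OF this, of N] have "val_ge (y * (g * inverse f) ^ N) (1 + int N)"
      by (intro val_ge_mult y) simp
    then have e: "val_ge (- (y * (g * inverse f) ^ N)) (1 + int N)" by simp
    then show "val_ge (h x - x) (int N)" unfolding hx by (auto elim: val_ge_mono)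
    show "h x \<noteq> 0" "fls_subdegree (h x) = fls_subdegree x"
      unfolding hx using subdegree_add_val_ge[OF y(3) e] y(4) by auto
  qed
  have "zeta_eps f \<epsilon> m = (\<Sum>\<^sub>\<infinity>lam\<in>Lam (int (N + 1) * int d - int i). inverse (polyT lam) ^ m)"
    unfolding zeta_eps_def Lambda_eps_monic_eq[OF eps] ..
  also have "\<dots> = (\<Sum>\<^sub>\<infinity>x\<in>monics i. inverse (polyT (coord (x * f ^ N))) ^ m)"
    by (rule infsum_reindex_bij_betw[OF bij_betw_coord[OF i], symmetric])
  also have "\<dots> = (\<Sum>\<^sub>\<infinity>x\<in>monics i. inverse (scale N) ^ m * inverse (h x) ^ m)"
    using scale_nonzero[of N] by (intro infsum_cong) (simp add: h_def power_mult_distrib field_simps)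
  also have "\<dots> = inverse (scale N) ^ m * (\<Sum>\<^sub>\<infinity>x\<in>monics i. inverse (h x) ^ m)"
    using summable_inverse_power[OF i \<open>m \<ge> 1\<close>, of h] h
    by (intro infsumI has_sum_fls_cmult_right has_sum_infsum) auto
  finally have "scale N ^ m * zeta_eps f \<epsilon> m = (\<Sum>\<^sub>\<infinity>x\<in>monics i. inverse (h x) ^ m)"
    using scale_nonzero[of N] by (simp add: field_simps)
  moreover have "((\<lambda>x. inverse (h x) ^ m) has_sum (\<Sum>\<^sub>\<infinity>x\<in>monics i. inverse (h x) ^ m)) (monics i)"
    using summable_inverse_power[OF i \<open>m \<ge> 1\<close>, of h] h by (intro has_sum_infsum) auto
  moreover have "((\<lambda>x. inverse x ^ m) has_sum zeta_monics i m) (monics i)"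
    using summable_inverse_power[OF i \<open>m \<ge> 1\<close>, of "\<lambda>x. x"] monicsD[OF i]
    by (intro has_sum_infsum) blast
  moreover have "val_ge (inverse (h x) ^ m - inverse x ^ m) (int N)" if x: "x \<in> monics i" for x
  proof -
    from monicsD[OF i x] have "x \<noteq> 0" "fls_subdegree x \<le> - int d" by metis+
    then show ?thesis using h[OF x] by (intro val_ge_inverse_power_diff) auto
  qed
  ultimately show ?thesis using has_sum_fls_close by fastforce
qed

text \<open>For fixed i the rescaled zeta values converge to those of the ideal, the limit in the
  denominator is nonzero, and j does not see the rescaling.\<close>

lemma j_eps_tendsto:
  assumes i: "i < d" and N: "filterlim N at_top sequentially"
    and eps: "\<And>k. real CARD('a) powr - real_of_int (int (N k + 1) * int d - int i) < \<epsilon> k"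
      "\<And>k. \<epsilon> k \<le> real CARD('a) powr (1 - real_of_int (int (N k + 1) * int d - int i))"
  shows "conv_P1 (\<lambda>k. j_eps f (\<epsilon> k)) (j_ideal f d (ideal_a f d i))"
proof -
  let ?q = "CARD('a)"
  have q: "?q \<ge> 2" using one_less_CARD_field[where 'a='a] by simp
  have lim: "(\<lambda>k. scale (N k) ^ m * zeta_eps f (\<epsilon> k) m) \<longlonglongrightarrow> zeta_monics i m" if "m \<ge> 1" for m
    unfolding tendsto_fls_iff
  proof
    fix n
    have "eventually (\<lambda>k. nat n \<le> N k) sequentially"
      using N by (auto simp: filterlim_at_top)
    then show "eventually (\<lambda>k. val_ge (scale (N k) ^ m * zeta_eps f (\<epsilon> k) m - zeta_monics i m) n) sequentially"
      by eventually_elim (rule val_ge_mono[OF zeta_eps_approx[OF i that eps]], simp)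
  qed
  have q1: "?q - 1 \<ge> 1" using q by simp
  have q2: "?q^2 - 1 \<ge> 1"
    using q power_mono[of 2 ?q 2] by simp
  have "conv_P1 (\<lambda>k. j_of (scale (N k) ^ (?q - 1) * zeta_eps f (\<epsilon> k) (?q - 1))
      (scale (N k) ^ (?q^2 - 1) * zeta_eps f (\<epsilon> k) (?q^2 - 1)))
      (j_of (zeta_monics i (?q - 1)) (zeta_monics i (?q^2 - 1)))"
    by (intro conv_P1_j_of lim q1 q2 zeta_monics_nonzero i)
  \<comment> \<open>The exponents n (q - 1) in \<open>j_ideal\<close> have n = 1 and n = q + 1; the
    latter gives q^2 - 1.\<close>
  moreover have "(?q + 1) * (?q - 1) = ?q^2 - 1"
    by (simp add: algebra_simps power2_eq_square)
  ultimately show ?thesis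
    unfolding j_of_rescale[OF scale_nonzero] j_eps_def j_ideal_def zeta_ideal_def monics_def by simp
qed

section \<open>Radii and the set of all limits\<close>

lemma radius_exists:
  assumes "0 < \<epsilon>" "\<epsilon> \<le> 1"
  obtains N i where "i < d" "real CARD('a) powr - real_of_int (int (N + 1) * int d - int i) < \<epsilon>"
    "\<epsilon> \<le> real CARD('a) powr (1 - real_of_int (int (N + 1) * int d - int i))"
proof -
  let ?q = "real CARD('a)"
  have q: "1 < ?q" using one_less_CARD_field[where 'a='a] by simp
  define t where "t = log ?q \<epsilon>"
  have t: "\<epsilon> = ?q powr t" "t \<le> 0" using q assms by (auto simp: t_def)
  define m where "m = nat \<lfloor>- t\<rfloor>"
  have m: "real m \<le> - t" "- t < real m + 1" using t(2) unfolding m_def by linarith+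
  \<comment> \<open>The radius lies between q^(-m-1) and q^(-m), so M = m + 1. Division of m by d
    gives M = (N + 1) d - i with N = m div d and this i.\<close>
  define i where "i = d - 1 - m mod d"
  have md: "m mod d < d" using deg_pos by simp
  have "int (m div d + 1) * int d - int i = int m + 1"
  proof -
    have "int i = int d - 1 - int (m mod d)" using md by (simp add: i_def of_nat_diff)
    moreover have "int (m div d) * int d + int (m mod d) = int m"
      by (metis div_mult_mod_eq of_nat_add of_nat_mult)
    ultimately show ?thesis by (simp add: algebra_simps)
  qed
  moreover have "i < d" using deg_pos by (simp add: i_def)
  moreover have "?q powr - real_of_int (int m + 1) < \<epsilon>" "\<epsilon> \<le> ?q powr (1 - real_of_int (int m + 1))"
    using m q by (auto simp: t(1))
  ultimately show thesis using that by metis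
qed

text \<open>If \<epsilon> k is below q^(-B d), its lower bound forces (N k + 1) d - i > B d, hence N
  k \<ge> B.\<close>

lemma radius_tendsto_0_imp:
  assumes "\<epsilon> \<longlonglongrightarrow> 0" "\<And>k. real CARD('a) powr - real_of_int (int (N k + 1) * int d - int i) < \<epsilon> k"
  shows "filterlim N at_top sequentially"
  unfolding filterlim_at_top
proof
  fix B :: nat
  let ?q = "real CARD('a)"
  have q: "1 < ?q" using one_less_CARD_field[where 'a='a] by simp
  have "eventually (\<lambda>k. \<epsilon> k < ?q powr - real (B * d)) sequentially"
    using order_tendstoD(2)[OF assms(1), of "?q powr - real (B * d)"] q by simp
  then show "eventually (\<lambda>k. B \<le> N k) sequentially"
  proof eventually_elim
    case (elim k)
    with assms(2)[of k] have "?q powr - real_of_int (int (N k + 1) * int d - int i) < ?q powr - real (B * d)"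
      by (rule less_trans)
    then have "real (B * d) < real_of_int (int (N k + 1) * int d - int i)" using q by simp
    then have "int (B * d) < int (N k + 1) * int d" by linarith
    then have "B * d < (N k + 1) * d" by (metis of_nat_less_iff of_nat_mult)
    then have "B < N k + 1" by (rule mult_less_cancel2[THEN iffD1, THEN conjunct2])
    then show ?case by simp
  qed
qed

lemma jqt_eq: "jqt f = {j_ideal f d (ideal_a f d i) | i. i < d}"
proof (intro equalityI subsetI)
  fix l assume "l \<in> {j_ideal f d (ideal_a f d i) | i. i < d}"
  then obtain i where i: "i < d" and l: "l = j_ideal f d (ideal_a f d i)" by auto
  let ?q = "real CARD('a)"
  have q: "1 < ?q" using one_less_CARD_field[where 'a='a] by simp
  \<comment> \<open>For each k the radius is the upper end of the interval belonging to N = k and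
    the given i.\<close>
  define \<epsilon> where "\<epsilon> k = ?q powr (1 - real_of_int (int (k + 1) * int d - int i))" for k
  have "\<epsilon> k \<le> inverse ?q ^ k" for k
  proof -
    have "k * 1 \<le> k * d" using deg_pos by (intro mult_le_mono2)
    then have "int k \<le> int k * int d" by (simp flip: of_nat_mult)
    then have "int k \<le> int (k + 1) * int d - int i - 1"
      using i by (simp add: algebra_simps)
    then have "1 - real_of_int (int (k + 1) * int d - int i) \<le> - real k" by linarith
    then have "\<epsilon> k \<le> ?q powr - real k" unfolding \<epsilon>_def using q by simp
    also have "\<dots> = inverse ?q ^ k" using q by (simp add: powr_minus powr_realpow power_inverse)
    finally show ?thesis .
  qed
  moreover have pos: "\<epsilon> k > 0" for k using q by (simp add: \<epsilon>_def)
  moreover have "(\<lambda>k. inverse ?q ^ k) \<longlonglongrightarrow> 0"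
    using q by (intro LIMSEQ_power_zero) (simp add: inverse_less_1_iff)
  ultimately have "\<epsilon> \<longlonglongrightarrow> 0"
    by (intro real_tendsto_sandwich[of "\<lambda>_. 0" \<epsilon> _ "\<lambda>k. inverse ?q ^ k"]) (auto intro: less_imp_le always_eventually)
  moreover have "conv_P1 (\<lambda>k. j_eps f (\<epsilon> k)) l"
    unfolding l using q by (intro j_eps_tendsto[OF i filterlim_ident]) (simp_all add: \<epsilon>_def)
  ultimately show "l \<in> jqt f" using pos by (auto simp: jqt_def)
next
  fix l assume "l \<in> jqt f"
  then obtain \<epsilon> where \<epsilon>: "\<And>k. \<epsilon> k > 0" "\<epsilon> \<longlonglongrightarrow> 0" and l: "conv_P1 (\<lambda>k. j_eps f (\<epsilon> k)) l"
    by (auto simp: jqt_def)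
  have "eventually (\<lambda>k. \<epsilon> k < 1) sequentially" using order_tendstoD(2)[OF \<epsilon>(2), of 1] by simp
  \<comment> \<open>Radii above 1 are outside the scope of \<open>radius_exists\<close>; only
    finitely many occur, so they do not affect the limit.\<close>
  then obtain k0 where k0: "\<And>k. k \<ge> k0 \<Longrightarrow> \<epsilon> k \<le> 1"
    unfolding eventually_sequentially by (meson less_imp_le)
  define P where "P k N i \<longleftrightarrow> i < d \<and>
    real CARD('a) powr - real_of_int (int (N + 1) * int d - int i) < \<epsilon> k \<and>
    \<epsilon> k \<le> real CARD('a) powr (1 - real_of_int (int (N + 1) * int d - int i))" for k N i
  have "\<exists>N i. P k N i" if "k \<ge> k0" for k
    using radius_exists[OF \<epsilon>(1) k0[OF that]] unfolding P_def by metis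
  then obtain N I where NI: "\<And>k. k \<ge> k0 \<Longrightarrow> P k (N k) (I k)" by metis
  have "infinite {k0..}" "finite (I ` {k0..})"
    using NI by (auto simp: P_def infinite_Ici intro!: finite_subset[of _ "{..<d}"])
  \<comment> \<open>The index i takes only d values, so one of them recurs infinitely often. Along
    that subsequence the limit is the j-value of the corresponding ideal, and it must equal
    l.\<close>
  from pigeonhole_infinite[OF this] obtain k1 where
    k1: "k1 \<in> {k0..}" "infinite {k \<in> {k0..}. I k = I k1}" by blast
  from infinite_enumerate[OF k1(2)] obtain r where
    r: "strict_mono (r :: nat \<Rightarrow> nat)" "\<And>n. r n \<in> {k \<in> {k0..}. I k = I k1}" by blast
  have P: "P (r n) (N (r n)) (I k1)" for n using NI[of "r n"] r(2)[of n] by simp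
  have i: "I k1 < d" using P by (simp add: P_def)
  have eps_r: "(\<lambda>n. \<epsilon> (r n)) \<longlonglongrightarrow> 0"
    using LIMSEQ_subseq_LIMSEQ[OF \<epsilon>(2) r(1)] by (simp add: comp_def)
  have "conv_P1 (\<lambda>n. j_eps f (\<epsilon> (r n))) (j_ideal f d (ideal_a f d (I k1)))"
    using P by (intro j_eps_tendsto[OF i, of "\<lambda>n. N (r n)"] radius_tendsto_0_imp[OF eps_r])
      (auto simp: P_def)
  moreover have "conv_P1 (\<lambda>n. j_eps f (\<epsilon> (r n))) l"
    using conv_P1_subseq[OF l r(1)] by (simp add: comp_def)
  ultimately have "l = j_ideal f d (ideal_a f d (I k1))" using conv_P1_unique by blast
  then show "l \<in> {j_ideal f d (ideal_a f d i) | i. i < d}" using i by blast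
qed

end

theorem theorem4:
  fixes f :: "'a::{field,finite} fls" and a :: "'a poly" and b :: 'a
  assumes "f \<notin> kfield"
    and "lead_coeff a = 1" and "degree a \<ge> 1"
    and "b \<noteq> 0"
    and "f ^ 2 - polyT a * f - fls_const b = 0"
    and "absv f = real CARD('a) ^ degree a"
  shows "jqt f = {j_ideal f (degree a) (ideal_a f (degree a) i) | i. i < degree a}"
proof -
  interpret quadratic_unit f a b
    using assms by unfold_locales
  show ?thesis by (rule jqt_eq)
qed

end
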